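(* Let $d\ge3$ and let $\Omega\subsetneq\mathbb R^d$ be a domain. For a constant $\beta<d-2$, if there exists a constant $A_\beta$ such that $$\sup_{p\in\Omega^c,\,r>0}\frac1{r^\beta}\int_{B_r(p)}\frac1{d(y,\Omega^c)^{d-\beta}}\,dy\le A_\beta<\infty,$$ then the function $$\phi(x):=\int_{\mathbb R^d}|x-y|^{-d+2}\rho(y)^{-d+\beta}\,dy$$ is a superharmonic function on $\mathbb R^d$ with $-\Delta\phi=N(d)\rho^{-d+\beta}$, where $N(d)$ is a constant depending only on $d$. Moreover, $$N^{-1}\rho(x)^{-d+2+\beta}\le\phi(x)\le N\rho(x)^{-d+2+\beta}\quad\text{for all }x\in\mathbb R^d,$$ where $N=N(d,\beta,A_\beta)$.
   Context: $\rho(x)=d(x,\partial\Omega)$, and $\frac10:=\infty$. Superharmonic on $\mathbb R^d$ means $\phi\in L^1_{loc}(\mathbb R^d)$ and $\int\phi\,\Delta\zeta\,dx\le0$ for all $0\le\zeta\in C_c^\infty(\mathbb R^d)$; the identity for $-\Delta\phi$ is in the sense of distributions on $\mathbb R^d$. *)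

theory Defs
  imports "HOL-Analysis.Analysis"
begin

definition partial_deriv :: "'a \<Rightarrow> ('a::euclidean_space \<Rightarrow> real) \<Rightarrow> 'a \<Rightarrow> real" where
  "partial_deriv v f x = frechet_derivative f (at x) v"

primrec Ck :: "nat \<Rightarrow> ('a::euclidean_space \<Rightarrow> real) \<Rightarrow> bool" where
  "Ck 0 f \<longleftrightarrow> continuous_on UNIV f"
| "Ck (Suc k) f \<longleftrightarrow> (\<forall>x. f differentiable (at x)) \<and> (\<forall>i\<in>Basis. Ck k (partial_deriv i f))"

definition test_function :: "('a::euclidean_space \<Rightarrow> real) \<Rightarrow> bool" where
  "test_function \<zeta> \<longleftrightarrow> (\<forall>k. Ck k \<zeta>) \<and> compact (closure {x. \<zeta> x \<noteq> 0})"

definition laplacian :: "('a::euclidean_space \<Rightarrow> real) \<Rightarrow> 'a \<Rightarrow> real" where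
  "laplacian f x = (\<Sum>i\<in>Basis. partial_deriv i (partial_deriv i f) x)"

(* Functions may take infinite values, so the condition includes finiteness almost everywhere;
   this is what makes real_of_ereal harmless in the integrals below. *)
definition locally_integrable :: "('a::euclidean_space \<Rightarrow> ereal) \<Rightarrow> bool" where
  "locally_integrable u \<longleftrightarrow> u \<in> borel_measurable lborel \<and>
     (\<forall>K. compact K \<longrightarrow> (\<integral>\<^sup>+x\<in>K. e2ennreal \<bar>u x\<bar> \<partial>lborel) < \<infinity>)"

definition superharmonic :: "('a::euclidean_space \<Rightarrow> ereal) \<Rightarrow> bool" where
  "superharmonic u \<longleftrightarrow> locally_integrable u \<and>
     (\<forall>\<zeta>. test_function \<zeta> \<and> (\<forall>x. 0 \<le> \<zeta> x) \<longrightarrow>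
        (\<integral>x. real_of_ereal (u x) * laplacian \<zeta> x \<partial>lborel) \<le> 0)"

(* The identity - Delta u = f in the sense of distributions on the whole space. *)
definition neg_laplacian_distr :: "('a::euclidean_space \<Rightarrow> ereal) \<Rightarrow> ('a \<Rightarrow> ereal) \<Rightarrow> bool" where
  "neg_laplacian_distr u f \<longleftrightarrow> locally_integrable u \<and> locally_integrable f \<and>
     (\<forall>\<zeta>. test_function \<zeta> \<longrightarrow>
        - (\<integral>x. real_of_ereal (u x) * laplacian \<zeta> x \<partial>lborel)
        = (\<integral>x. real_of_ereal (f x) * \<zeta> x \<partial>lborel))"

(* t to the power -s for t \<ge> 0 and s > 0. Division is that of ennreal, where 1 / 0 = \<infinity>,
   so recip_powr 0 s = \<infinity>. *)
definition recip_powr :: "real \<Rightarrow> real \<Rightarrow> ennreal" where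
  "recip_powr t s = 1 / ennreal (t powr s)"

definition bdist :: "'a::euclidean_space set \<Rightarrow> 'a \<Rightarrow> real" where
  "bdist \<Omega> x = infdist x (frontier \<Omega>)"

definition potential :: "'a::euclidean_space set \<Rightarrow> real \<Rightarrow> 'a \<Rightarrow> ennreal" where
  "potential \<Omega> \<beta> x = (\<integral>\<^sup>+y. recip_powr (norm (x - y)) (real DIM('a) - 2)
                          * recip_powr (bdist \<Omega> y) (real DIM('a) - \<beta>) \<partial>lborel)"

end

theory Submission
  imports Defs
begin

text \<open>The hypothesis forces the closed set \<open>K = - \<Omega>\<close> to be Lebesgue null, so \<open>frontier \<Omega> = K\<close> and \<open>\<rho>\<close> is
  the distance to \<open>K\<close>. For the upper bound at \<open>x\<close>, split the potential at \<open>|x - y| = \<rho>(x) / 2\<close>: inside,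
  the weight is comparable to \<open>\<rho>(x)\<close> to the power \<open>\<beta> - d\<close>; outside, sum over dyadic shells, each contained
  in a ball about the nearest point of \<open>K\<close>, the series converging because \<open>\<beta> < d - 2\<close>. For the lower
  bound, restrict the potential to a ball of radius \<open>\<rho>(x)\<close>, or of radius tending to \<open>0\<close> when \<open>\<rho>(x) = 0\<close>.
  Since \<open>\<rho> < r\<close> on a ball of radius \<open>r\<close> about a point of \<open>K\<close>, the upper bound also gives local
  integrability of the potential, and Fubini reduces the distributional identity to the fundamental solution
  of the Laplacian. The latter follows by regularizing the kernel to \<open>(\<epsilon>\<^sup>2 + |x|\<^sup>2)\<close> to the power
  \<open>(2 - d) / 2\<close>, whose Laplacian is an integrable approximate identity up to a negative factor.\<close>

section \<open>Dyadic shell estimates\<close>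

lemma recip_powr_pos: "0 < t \<Longrightarrow> recip_powr t s = ennreal (t powr - s)"
  by (simp add: recip_powr_def divide_ennreal powr_minus_divide flip: ennreal_1)

lemma recip_powr_zero [simp]: "recip_powr 0 s = \<infinity>"
  by (simp add: recip_powr_def ennreal_divide_zero)

lemma recip_powr_antimono:
  assumes "0 \<le> a" "a \<le> b" "0 \<le> s"
  shows "recip_powr b s \<le> recip_powr a s"
proof (cases "a = 0")
  case False
  with assms show ?thesis
    by (auto simp: recip_powr_pos intro!: ennreal_leI powr_mono2')
qed simp

lemma measurable_recip_powr [measurable (raw)]:
  assumes [measurable]: "f \<in> borel_measurable M"
  shows "(\<lambda>x. recip_powr (f x) s) \<in> borel_measurable M"
  unfolding recip_powr_def by measurable

text \<open>Each point of \<open>S\<close> lies in some \<open>T k\<close>, and that single term of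
  the nonnegative series already dominates the integrand. Below, the \<open>T k\<close> are shells
  on which the kernel \<open>h\<close> is bounded by a constant.\<close>

lemma nn_integral_le_sum_over_cover:
  fixes g h :: "'a \<Rightarrow> ennreal"
  assumes [measurable]: "g \<in> borel_measurable M" "\<And>k::nat. T k \<in> sets M"
    and cover: "\<And>y. y \<in> S \<Longrightarrow> y \<in> space M \<Longrightarrow> \<exists>k. y \<in> T k"
    and h: "\<And>k y. y \<in> T k \<Longrightarrow> h y \<le> c k"
  shows "(\<integral>\<^sup>+y\<in>S. h y * g y \<partial>M) \<le> (\<Sum>k. c k * (\<integral>\<^sup>+y\<in>T k. g y \<partial>M))"
proof -
  have "(\<integral>\<^sup>+y\<in>S. h y * g y \<partial>M) \<le> (\<integral>\<^sup>+y. (\<Sum>k. c k * (g y * indicator (T k) y)) \<partial>M)"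
  proof (intro nn_integral_mono)
    fix y assume y: "y \<in> space M"
    show "h y * g y * indicator S y \<le> (\<Sum>k. c k * (g y * indicator (T k) y))"
    proof (cases "y \<in> S")
      case True
      then obtain k where k: "y \<in> T k" using cover y by blast
      have "h y * g y * indicator S y \<le> c k * (g y * indicator (T k) y)"
        using True k h[OF k] by (simp add: mult_right_mono)
      also have "\<dots> = (\<Sum>k\<in>{k}. c k * (g y * indicator (T k) y))"
        by simp
      also have "\<dots> \<le> (\<Sum>k. c k * (g y * indicator (T k) y))"
        by (rule sum_le_suminf) auto
      finally show ?thesis .
    qed simp
  qed
  also have "\<dots> = (\<Sum>k. c k * (\<integral>\<^sup>+y\<in>T k. g y \<partial>M))"
    by (subst nn_integral_suminf) (auto simp: nn_integral_cmult)
  finally show ?thesis .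
qed

lemma suminf_ennreal_geometric_le:
  assumes "\<And>k::nat. u k \<le> ennreal (C * t ^ k)" "0 \<le> C" "0 \<le> t" "t < 1"
  shows "(\<Sum>k. u k) \<le> ennreal (C / (1 - t))"
proof -
  have "(\<lambda>k. C * t ^ k) sums (C * (1 / (1 - t)))"
    using assms by (intro sums_mult geometric_sums) auto
  then have "(\<Sum>k. ennreal (C * t ^ k)) = ennreal (C / (1 - t))"
    using assms by (subst suminf_ennreal_eq[where x = "C * (1 / (1 - t))"]) auto
  moreover have "(\<Sum>k. u k) \<le> (\<Sum>k. ennreal (C * t ^ k))"
    using assms by (intro suminf_le) auto
  ultimately show ?thesis by simp
qed

text \<open>On the shell between radii \<open>2 ^ k * R\<close> and \<open>2 ^ (k + 1) * R\<close>
  the kernel is bounded by its value at the inner radius and the mass of \<open>g\<close> by that of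
  the outer ball. The products form a geometric series with ratio
  \<open>2 powr (\<gamma> - q)\<close>, and the doubled outer radius contributes
  \<open>2 powr \<gamma>\<close>.\<close>

lemma nn_integral_recip_powr_outside_ball:
  fixes x :: "'a::euclidean_space"
  assumes g [measurable]: "g \<in> borel_measurable borel"
    and R: "0 < R" and C: "0 \<le> C" and q: "\<gamma> < q" "0 \<le> q"
    and bound: "\<And>r. R \<le> r \<Longrightarrow> (\<integral>\<^sup>+y\<in>ball x r. g y \<partial>lborel) \<le> ennreal (C * r powr \<gamma>)"
  shows "(\<integral>\<^sup>+y\<in>- ball x R. recip_powr (norm (x - y)) q * g y \<partial>lborel)
    \<le> ennreal (2 powr \<gamma> / (1 - 2 powr (\<gamma> - q)) * C * R powr (\<gamma> - q))"
proof -
  define r where "r k = 2 ^ k * R" for k :: nat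
  have rpos: "0 < r k" and rR: "R \<le> r k" and rS: "r (Suc k) = 2 * r k" for k
    using R by (auto simp: r_def)
  let ?T = "\<lambda>k. ball x (r (Suc k)) - ball x (r k)"
  have cover: "\<exists>k. y \<in> ?T k" if "y \<in> - ball x R" for y
  proof -
    obtain n where "dist x y / R < 2 ^ n"
      using real_arch_pow[of 2 "dist x y / R"] by auto
    then have "dist x y < r n" using R by (simp add: r_def field_simps)
    moreover have "\<not> dist x y < r 0" using that by (simp add: r_def)
    \<comment> \<open>The shell index is one less than the first index whose radius exceeds
      \<open>dist x y\<close>; that first index is not \<open>0\<close> because \<open>y\<close>
      lies outside \<open>ball x R\<close>.\<close>
    ultimately show ?thesis
      using ex_least_nat_less[of "\<lambda>k. dist x y < r k" n] by auto
  qed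
  have powr_r: "r k powr s = R powr s * (2 powr s) ^ k" for k s
    using R by (simp add: r_def powr_mult powr_power mult.commute powr_realpow[symmetric] powr_powr)
  have "(\<integral>\<^sup>+y\<in>- ball x R. recip_powr (norm (x - y)) q * g y \<partial>lborel)
    \<le> (\<Sum>k. ennreal (r k powr - q) * (\<integral>\<^sup>+y\<in>?T k. g y \<partial>lborel))"
  proof (rule nn_integral_le_sum_over_cover)
    fix k y assume "y \<in> ?T k"
    then have "recip_powr (norm (x - y)) q \<le> recip_powr (r k) q"
      using rpos[of k] q by (intro recip_powr_antimono) (auto simp: dist_norm)
    then show "recip_powr (norm (x - y)) q \<le> ennreal (r k powr - q)"
      using rpos by (simp add: recip_powr_pos)
  qed (use cover in auto)
  also have "\<dots> \<le> ennreal ((2 powr \<gamma> * C * R powr (\<gamma> - q)) / (1 - 2 powr (\<gamma> - q)))"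
  proof (rule suminf_ennreal_geometric_le)
    fix k
    have "(\<integral>\<^sup>+y\<in>?T k. g y \<partial>lborel) \<le> (\<integral>\<^sup>+y\<in>ball x (r (Suc k)). g y \<partial>lborel)"
      by (intro nn_integral_mono) (auto split: split_indicator)
    also have "\<dots> \<le> ennreal (C * r (Suc k) powr \<gamma>)"
      by (intro bound rR)
    finally have "ennreal (r k powr - q) * (\<integral>\<^sup>+y\<in>?T k. g y \<partial>lborel)
      \<le> ennreal (r k powr - q) * ennreal (C * r (Suc k) powr \<gamma>)"
      by (rule mult_left_mono) simp
    also have "\<dots> = ennreal (2 powr \<gamma> * C * (r k powr - q * r k powr \<gamma>))"
      using rpos[of k] by (simp add: rS powr_mult ac_simps flip: ennreal_mult')
    also have "r k powr - q * r k powr \<gamma> = r k powr (\<gamma> - q)"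
      by (simp flip: powr_add)
    also have "ennreal (2 powr \<gamma> * C * r k powr (\<gamma> - q))
      = ennreal (2 powr \<gamma> * C * R powr (\<gamma> - q) * (2 powr (\<gamma> - q)) ^ k)"
      by (simp add: powr_r ac_simps)
    finally show "ennreal (r k powr - q) * (\<integral>\<^sup>+y\<in>?T k. g y \<partial>lborel) \<le> \<dots>" .
  qed (use C q in \<open>auto intro!: powr_less_one\<close>)
  finally show ?thesis by (simp add: ac_simps)
qed

text \<open>Here the shells shrink by halves towards \<open>x\<close>. The inner radius of a shell
  bounds the kernel, at the cost of \<open>2 powr q\<close>, and the volume of the outer ball bounds
  the mass; the ratio \<open>2 powr (q - DIM('a))\<close> is below 1 because \<open>q\<close> is
  below the dimension.\<close>

lemma nn_integral_recip_powr_ball: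
  fixes x :: "'a::euclidean_space" and q :: real
  assumes R: "0 < R" and q: "q < DIM('a)" "0 \<le> q"
  shows "(\<integral>\<^sup>+y\<in>ball x R. recip_powr (norm (x - y)) q \<partial>lborel)
    \<le> ennreal (2 powr q * unit_ball_vol DIM('a) / (1 - 2 powr (q - DIM('a))) * R powr (DIM('a) - q))"
proof -
  define r where "r k = (1/2) ^ k * R" for k :: nat
  have rpos: "0 < r k" and rS: "r (Suc k) = r k / 2" for k
    using R by (auto simp: r_def)
  let ?T = "\<lambda>k. ball x (r k) - ball x (r (Suc k))"
  let ?c = "unit_ball_vol DIM('a)"
  have c: "0 \<le> ?c" by simp
  have cover: "\<exists>k. y \<in> ?T k" if "y \<in> ball x R - {x}" for y
  proof -
    have "0 < dist x y / R"
      using that R by (intro divide_pos_pos) auto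
    then obtain n where "(1/2) ^ n < dist x y / R"
      using real_arch_pow_inv[of "dist x y / R" "1/2"] by auto
    then have "r n \<le> dist x y" using R by (simp add: r_def field_simps)
    moreover have "\<not> r 0 \<le> dist x y" using that by (simp add: r_def)
    ultimately show ?thesis
      using ex_least_nat_less[of "\<lambda>k. r k \<le> dist x y" n] by (auto simp: not_le)
  qed
  have powr_r: "r k powr s = R powr s * (2 powr - s) ^ k" for k s
    using R by (simp add: r_def powr_mult powr_power mult.commute powr_realpow[symmetric] powr_powr
        powr_divide powr_minus_divide)
  \<comment> \<open>No shell contains the centre, where the kernel is infinite; a single point is
    null and can be removed.\<close>
  have "(\<integral>\<^sup>+y\<in>ball x R. recip_powr (norm (x - y)) q \<partial>lborel)
    = (\<integral>\<^sup>+y\<in>ball x R - {x}. recip_powr (norm (x - y)) q * 1 \<partial>lborel)"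
    using AE_lborel_singleton[of x] by (intro nn_integral_cong_AE) (auto split: split_indicator)
  also have "\<dots> \<le> (\<Sum>k. ennreal (r (Suc k) powr - q) * (\<integral>\<^sup>+y\<in>?T k. 1 \<partial>lborel))"
  proof (rule nn_integral_le_sum_over_cover)
    fix k y assume "y \<in> ?T k"
    then have "recip_powr (norm (x - y)) q \<le> recip_powr (r (Suc k)) q"
      using rpos[of "Suc k"] q by (intro recip_powr_antimono) (auto simp: dist_norm)
    then show "recip_powr (norm (x - y)) q \<le> ennreal (r (Suc k) powr - q)"
      using rpos[of "Suc k"] by (simp add: recip_powr_pos)
  qed (use cover in auto)
  also have "\<dots> \<le> ennreal ((2 powr q * ?c * R powr (DIM('a) - q)) / (1 - 2 powr (q - DIM('a))))"
  proof (rule suminf_ennreal_geometric_le)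
    fix k
    have "(\<integral>\<^sup>+y\<in>?T k. 1 \<partial>lborel) \<le> (\<integral>\<^sup>+y\<in>ball x (r k). 1 \<partial>lborel)"
      by (intro nn_integral_mono) (auto split: split_indicator)
    also have "\<dots> = ennreal (?c * r k powr DIM('a))"
      using rpos[of k] by (simp add: emeasure_ball powr_realpow)
    finally have "ennreal (r (Suc k) powr - q) * (\<integral>\<^sup>+y\<in>?T k. 1 \<partial>lborel)
      \<le> ennreal (r (Suc k) powr - q) * ennreal (?c * r k powr DIM('a))"
      by (rule mult_left_mono) simp
    also have "\<dots> = ennreal (2 powr q * ?c * (r k powr - q * r k powr DIM('a)))"
      using rpos[of k] by (simp add: rS powr_divide powr_minus_divide ac_simps flip: ennreal_mult')
    also have "r k powr - q * r k powr DIM('a) = r k powr (DIM('a) - q)"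
      by (simp flip: powr_add)
    also have "ennreal (2 powr q * ?c * r k powr (DIM('a) - q))
      = ennreal (2 powr q * ?c * R powr (DIM('a) - q) * (2 powr (q - DIM('a))) ^ k)"
      by (simp add: powr_r ac_simps)
    finally show "ennreal (r (Suc k) powr - q) * (\<integral>\<^sup>+y\<in>?T k. 1 \<partial>lborel) \<le> \<dots>" .
  qed (use c q in \<open>auto intro!: powr_less_one\<close>)
  finally show ?thesis by (simp add: ac_simps)
qed

section \<open>Integration by parts for test functions\<close>

lemma partial_deriv_eqI:
  assumes "(f has_derivative f') (at x)"
  shows "partial_deriv v f x = f' v"
  using frechet_derivative_at[OF assms] by (simp add: partial_deriv_def)

lemma has_real_derivative_along_line:
  fixes f :: "'a::euclidean_space \<Rightarrow> real"
  assumes "f differentiable (at (x + t *\<^sub>R v))"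
  shows "((\<lambda>t. f (x + t *\<^sub>R v)) has_real_derivative partial_deriv v f (x + t *\<^sub>R v)) (at t)"
proof -
  let ?D = "frechet_derivative f (at (x + t *\<^sub>R v))"
  have D: "(f has_derivative ?D) (at (x + t *\<^sub>R v))"
    using assms frechet_derivative_works by blast
  have "((\<lambda>t. f (x + t *\<^sub>R v)) has_derivative (\<lambda>s. ?D (s *\<^sub>R v))) (at t)"
    by (rule has_derivative_compose[of "\<lambda>t. x + t *\<^sub>R v", OF _ D]) (auto intro!: derivative_eq_intros)
  moreover have "(\<lambda>s. ?D (s *\<^sub>R v)) = (*) (?D v)"
    using linear_cmul[OF has_derivative_linear[OF D]] by (auto simp: mult.commute)
  ultimately show ?thesis
    by (simp add: has_field_derivative_def partial_deriv_def)
qed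

text \<open>The complement of \<open>K\<close> is open, so \<open>f\<close> vanishes on a whole
  neighbourhood of \<open>x\<close>. This carries a compact support over to all derivatives.\<close>

lemma partial_deriv_eq_0_outside_support:
  fixes f :: "'a::euclidean_space \<Rightarrow> real"
  assumes "closed K" "\<And>x. x \<notin> K \<Longrightarrow> f x = 0" "x \<notin> K"
  shows "partial_deriv v f x = 0"
proof -
  have "(f has_derivative (\<lambda>_. 0)) (at x)"
    by (rule has_derivative_transform_within_open[of "\<lambda>_. 0" _ _ _ "- K"])
       (use assms in auto)
  then show ?thesis by (rule partial_deriv_eqI)
qed

lemma integrable_continuous_compact_support:
  fixes f :: "'a::euclidean_space \<Rightarrow> real"
  assumes "continuous_on UNIV f" "compact K" "\<And>x. x \<notin> K \<Longrightarrow> f x = 0"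
  shows "integrable lborel f"
proof -
  have "integrable lborel (\<lambda>x. indicator K x *\<^sub>R f x)"
    using borel_integrable_compact[of K f] assms continuous_on_subset by blast
  moreover have "(\<lambda>x. indicator K x *\<^sub>R f x) = f"
    using assms by (auto split: split_indicator)
  ultimately show ?thesis by simp
qed

lemma integral_lborel_translate:
  fixes f :: "'a::euclidean_space \<Rightarrow> real"
  assumes [measurable]: "f \<in> borel_measurable borel"
  shows "(\<integral>x. f (c + x) \<partial>lborel) = (\<integral>x. f x \<partial>lborel)"
  using integral_distr[of "(+) c" lborel borel f] by (simp add: lborel_distr_plus)

lemma bounded_continuous_compact_support:
  fixes f :: "'a::euclidean_space \<Rightarrow> real"
  assumes "continuous_on UNIV f" "compact K" "\<And>x. x \<notin> K \<Longrightarrow> f x = 0"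
  obtains M where "0 < M" "\<And>x. \<bar>f x\<bar> \<le> M"
proof -
  have "bounded (f ` K)"
    using compact_continuous_image[OF continuous_on_subset[OF assms(1)] assms(2)] compact_imp_bounded by simp
  then obtain M where M: "0 < M" "\<And>x. x \<in> K \<Longrightarrow> \<bar>f x\<bar> \<le> M"
    by (auto simp: bounded_pos)
  then have "\<bar>f x\<bar> \<le> M" for x
    using assms(3)[of x] by (cases "x \<in> K") auto
  with M that show ?thesis by blast
qed

text \<open>The integral of a difference quotient vanishes by translation invariance of Lebesgue measure;
  this replaces the divergence theorem.\<close>
lemma integral_partial_deriv_eq_0:
  fixes h :: "'a::euclidean_space \<Rightarrow> real"
  assumes diff: "\<And>x. h differentiable (at x)" and cont: "continuous_on UNIV (partial_deriv v h)"
    and K: "compact K" "\<And>x. x \<notin> K \<Longrightarrow> h x = 0"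
  shows "(\<integral>x. partial_deriv v h x \<partial>lborel) = 0"
proof -
  have hcont: "continuous_on UNIV h"
    using diff by (simp add: continuous_at_imp_continuous_on differentiable_imp_continuous_within)
  then have [measurable]: "h \<in> borel_measurable borel"
    by (rule borel_measurable_continuous_onI)
  have [measurable]: "partial_deriv v h \<in> borel_measurable borel"
    using cont by (rule borel_measurable_continuous_onI)
  have D0: "partial_deriv v h x = 0" if "x \<notin> K" for x
    using partial_deriv_eq_0_outside_support[of K h] compact_imp_closed K that by blast
  obtain M where M: "0 < M" "\<And>x. \<bar>partial_deriv v h x\<bar> \<le> M"
    using bounded_continuous_compact_support[OF cont K(1) D0] by blast
  obtain B where B: "\<And>x. x \<in> K \<Longrightarrow> norm x \<le> B"
    using K compact_imp_bounded bounded_iff by metis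
  define s where "s n = 1 / real (Suc n)" for n
  have s: "0 < s n" "s n \<le> 1" for n by (auto simp: s_def)
  define g where "g n x = (h (x + s n *\<^sub>R v) - h x) / s n" for n x
  have hint: "integrable lborel h"
    by (rule integrable_continuous_compact_support[OF hcont K])
  have int0: "(\<integral>x. g n x \<partial>lborel) = 0" for n
  proof -
    have "integrable lborel (\<lambda>x. h (s n *\<^sub>R v + x))"
      using hint by (subst (asm) lborel_distr_plus[of "s n *\<^sub>R v", symmetric]) (simp add: integrable_distr_eq)
    then show ?thesis
      using hint integral_lborel_translate[of h "s n *\<^sub>R v"] by (simp add: g_def add.commute)
  qed
  have "(\<lambda>n. \<integral>x. g n x \<partial>lborel) \<longlonglongrightarrow> (\<integral>x. partial_deriv v h x \<partial>lborel)"
  proof (rule integral_dominated_convergence)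
    \<comment> \<open>The step sizes \<open>s n\<close> are at most 1, so all difference quotients
      vanish outside one fixed ball; inside it the mean value theorem along the line bounds them by
      \<open>M\<close>.\<close>
    show "integrable lborel (\<lambda>x. M * indicator (cball 0 (B + norm v)) x)"
      by (intro integrable_mult_right integrable_real_indicator)
        (auto simp: emeasure_lborel_cball_finite[unfolded infinity_ennreal_def])
    show "AE x in lborel. (\<lambda>n. g n x) \<longlonglongrightarrow> partial_deriv v h x"
    proof (intro AE_I2)
      fix x
      have "(\<lambda>t. (h (x + (0 + t) *\<^sub>R v) - h (x + 0 *\<^sub>R v)) / t) \<midarrow>0\<rightarrow> partial_deriv v h x"
        using has_real_derivative_along_line[of h x 0 v] diff by (simp add: DERIV_def)
      moreover have "filterlim s (at 0) sequentially"
        unfolding filterlim_at s_def using LIMSEQ_inverse_real_of_nat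
        by (auto simp: inverse_eq_divide simp del: of_nat_Suc)
      ultimately show "(\<lambda>n. g n x) \<longlonglongrightarrow> partial_deriv v h x"
        using filterlim_compose by (fastforce simp: g_def)
    qed
    show "AE x in lborel. norm (g n x) \<le> M * indicator (cball 0 (B + norm v)) x" for n
    proof (intro AE_I2)
      fix x
      show "norm (g n x) \<le> M * indicator (cball 0 (B + norm v)) x"
      proof (cases "x \<in> cball 0 (B + norm v)")
        case True
        obtain z where "h (x + s n *\<^sub>R v) - h (x + 0 *\<^sub>R v) = (s n - 0) * partial_deriv v h (x + z *\<^sub>R v)"
          using MVT2[of 0 "s n" "\<lambda>t. h (x + t *\<^sub>R v)" "\<lambda>t. partial_deriv v h (x + t *\<^sub>R v)"]
            has_real_derivative_along_line diff s by metis
        then have "g n x = partial_deriv v h (x + z *\<^sub>R v)"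
          using s[of n] by (simp add: g_def)
        then show ?thesis using True M by simp
      next
        case False
        have "norm (s n *\<^sub>R v) \<le> norm v"
          using s[of n] by (simp add: mult_left_le_one_le)
        then have "B < norm x" "B < norm (x + s n *\<^sub>R v)"
          using False norm_diff_ineq[of x "s n *\<^sub>R v"] norm_ge_zero[of v] unfolding mem_cball_0 by linarith+
        then have "x \<notin> K" "x + s n *\<^sub>R v \<notin> K" using B by force+
        then show ?thesis using K False by (simp add: g_def)
      qed
    qed
  qed (auto simp: g_def)
  then show ?thesis using int0 by (simp add: LIMSEQ_const_iff)
qed

text \<open>The product \<open>u * w\<close> inherits the compact support of \<open>w\<close>, so
  its derivative integrates to 0; the product rule splits this integral into the two sides.\<close>

lemma integration_by_parts_compact_support:
  fixes u w :: "'a::euclidean_space \<Rightarrow> real"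
  assumes u: "\<And>x. u differentiable (at x)" "continuous_on UNIV (partial_deriv v u)"
    and w: "\<And>x. w differentiable (at x)" "continuous_on UNIV (partial_deriv v w)"
    and K: "compact K" "\<And>x. x \<notin> K \<Longrightarrow> w x = 0"
  shows "(\<integral>x. u x * partial_deriv v w x \<partial>lborel) = - (\<integral>x. partial_deriv v u x * w x \<partial>lborel)"
proof -
  have D: "partial_deriv v (\<lambda>x. u x * w x) = (\<lambda>x. u x * partial_deriv v w x + partial_deriv v u x * w x)"
  proof
    fix x
    have "((\<lambda>x. u x * w x) has_derivative (\<lambda>h. u x * frechet_derivative w (at x) h
        + frechet_derivative u (at x) h * w x)) (at x)"
      using u(1) w(1) by (intro has_derivative_mult) (simp_all flip: frechet_derivative_works)
    then show "partial_deriv v (\<lambda>x. u x * w x) x = u x * partial_deriv v w x + partial_deriv v u x * w x"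
      by (simp add: partial_deriv_eqI) (simp add: partial_deriv_def)
  qed
  have cont: "continuous_on UNIV u" "continuous_on UNIV w"
    using u w by (simp_all add: continuous_at_imp_continuous_on differentiable_imp_continuous_within)
  have D0: "partial_deriv v w x = 0" if "x \<notin> K" for x
    using partial_deriv_eq_0_outside_support[of K w] compact_imp_closed K that by blast
  have "(\<integral>x. partial_deriv v (\<lambda>x. u x * w x) x \<partial>lborel) = 0"
    by (rule integral_partial_deriv_eq_0[OF _ _ K(1)])
       (use K(2) u w cont in \<open>auto simp: D intro!: continuous_intros differentiable_mult\<close>)
  moreover have "integrable lborel (\<lambda>x. u x * partial_deriv v w x)"
    by (rule integrable_continuous_compact_support[OF _ K(1)]) (auto intro!: continuous_intros cont w simp: D0)
  moreover have "integrable lborel (\<lambda>x. partial_deriv v u x * w x)"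
    by (rule integrable_continuous_compact_support[OF _ K(1)]) (auto intro!: continuous_intros cont u simp: K)
  ultimately show ?thesis by (simp add: D)
qed

section \<open>Smoothness and supports of test functions, and Green's identity\<close>

lemma Ck_continuous: "Ck k f \<Longrightarrow> continuous_on UNIV f"
proof (cases k)
  case (Suc j)
  moreover assume "Ck k f"
  ultimately have "\<forall>x. f differentiable (at x)" by simp
  then show ?thesis
    by (simp add: continuous_at_imp_continuous_on differentiable_imp_continuous_within)
qed simp

lemma test_function_support:
  assumes "test_function \<zeta>"
  obtains K where "compact K" "\<And>x. x \<notin> K \<Longrightarrow> \<zeta> x = 0"
proof (rule that)
  show "\<zeta> x = 0" if "x \<notin> closure {x. \<zeta> x \<noteq> 0}" for x
    using that closure_subset[of "{x. \<zeta> x \<noteq> 0}"] by blast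
  show "compact (closure {x. \<zeta> x \<noteq> 0})"
    using assms by (simp only: test_function_def)
qed

lemma test_function_continuous: "test_function \<zeta> \<Longrightarrow> continuous_on UNIV \<zeta>"
  using Ck_continuous[of 0 \<zeta>] by (auto simp only: test_function_def)

lemma test_function_differentiable: "test_function \<zeta> \<Longrightarrow> \<zeta> differentiable (at x)"
  using Ck.simps(2)[of 0 \<zeta>] by (auto simp only: test_function_def)

text \<open>\<open>Ck (Suc k)\<close> of \<open>\<zeta>\<close> yields \<open>Ck k\<close> of its
  derivative for every \<open>k\<close>, and the support does not grow. Hence the Laplacian of a
  test function is a sum of test functions.\<close>

lemma test_function_partial_deriv:
  assumes "test_function \<zeta>" "i \<in> Basis"
  shows "test_function (partial_deriv i \<zeta>)"
proof -
  have "Ck k (partial_deriv i \<zeta>)" for k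
    using assms Ck.simps(2)[of k \<zeta>] by (auto simp: test_function_def)
  moreover have "compact (closure {x. partial_deriv i \<zeta> x \<noteq> 0})"
  proof -
    obtain K where K: "compact K" "\<And>x. x \<notin> K \<Longrightarrow> \<zeta> x = 0"
      using test_function_support[OF assms(1)] by blast
    then have "closure {x. partial_deriv i \<zeta> x \<noteq> 0} \<subseteq> K"
      using partial_deriv_eq_0_outside_support[of K \<zeta>] compact_imp_closed[OF K(1)]
      by (intro closure_minimal) blast+
    then show ?thesis
      using compact_Int_closed[OF K(1) closed_closure] by (metis inf.absorb_iff2)
  qed
  ultimately show ?thesis
    by (simp add: test_function_def)
qed

lemma test_function_laplacian_continuous:
  assumes "test_function \<zeta>"
  shows "continuous_on UNIV (laplacian \<zeta>)"
  unfolding laplacian_def[abs_def]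
  by (intro continuous_on_sum test_function_continuous test_function_partial_deriv assms)

lemma laplacian_eq_0_outside_support:
  assumes "closed K" "\<And>x. x \<notin> K \<Longrightarrow> f x = 0" "x \<notin> K"
  shows "laplacian f x = 0"
  unfolding laplacian_def
proof (intro sum.neutral ballI)
  fix i :: 'a
  have "partial_deriv i f y = 0" if "y \<notin> K" for y
    using partial_deriv_eq_0_outside_support[of K f y i] assms(1,2) that by blast
  then show "partial_deriv i (partial_deriv i f) x = 0"
    using partial_deriv_eq_0_outside_support[of K "partial_deriv i f" x i] assms(1,3) by blast
qed

text \<open>In each coordinate, two integrations by parts move both derivatives from
  \<open>\<zeta>\<close> to \<open>u\<close>. The compact set \<open>K\<close> supporting
  \<open>\<zeta>\<close> serves for all its derivatives as well, so every boundary term is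
  absent.\<close>

lemma green_test_function:
  fixes u :: "'a::euclidean_space \<Rightarrow> real"
  assumes \<zeta>: "test_function \<zeta>" and u: "Ck 2 u"
  shows "(\<integral>x. u x * laplacian \<zeta> x \<partial>lborel) = (\<integral>x. laplacian u x * \<zeta> x \<partial>lborel)"
proof -
  obtain K where K: "compact K" and supp: "\<And>x. x \<notin> K \<Longrightarrow> \<zeta> x = 0"
    using test_function_support[OF \<zeta>] by blast
  have supp1: "partial_deriv i \<zeta> x = 0" if "x \<notin> K" for i x
    using partial_deriv_eq_0_outside_support[of K \<zeta>] compact_imp_closed[OF K] supp that by blast
  have supp2: "partial_deriv i (partial_deriv i \<zeta>) x = 0" if "x \<notin> K" for i x
    using partial_deriv_eq_0_outside_support[of K "partial_deriv i \<zeta>"] compact_imp_closed[OF K] supp1 that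
    by blast
  have u1: "Ck 1 (partial_deriv i u)" "\<And>x. u differentiable (at x)" if "i \<in> Basis" for i
    using u that by (auto simp: numeral_2_eq_2)
  have u2: "continuous_on UNIV (partial_deriv i (partial_deriv i u))"
      "\<And>x. partial_deriv i u differentiable (at x)" if "i \<in> Basis" for i
    using u1[OF that] that by auto
  have ucont: "continuous_on UNIV u" using Ck_continuous[OF u] .
  have \<zeta>1: "test_function (partial_deriv i \<zeta>)" if "i \<in> Basis" for i
    using test_function_partial_deriv[OF \<zeta> that] .
  have \<zeta>2: "continuous_on UNIV (partial_deriv i (partial_deriv i \<zeta>))" if "i \<in> Basis" for i
    using test_function_continuous[OF test_function_partial_deriv[OF \<zeta>1]] that by blast
  note \<zeta>0 = test_function_continuous[OF \<zeta>]
  have part: "(\<integral>x. u x * partial_deriv i (partial_deriv i \<zeta>) x \<partial>lborel)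
      = (\<integral>x. partial_deriv i (partial_deriv i u) x * \<zeta> x \<partial>lborel)" if i: "i \<in> Basis" for i
  proof -
    have "(\<integral>x. u x * partial_deriv i (partial_deriv i \<zeta>) x \<partial>lborel)
      = - (\<integral>x. partial_deriv i u x * partial_deriv i \<zeta> x \<partial>lborel)"
      by (rule integration_by_parts_compact_support[OF _ _ _ _ K])
         (auto intro!: u1(2)[OF i] Ck_continuous[OF u1(1)[OF i]] test_function_differentiable[OF \<zeta>1[OF i]]
           \<zeta>2[OF i] supp1)
    moreover have "(\<integral>x. partial_deriv i u x * partial_deriv i \<zeta> x \<partial>lborel)
      = - (\<integral>x. partial_deriv i (partial_deriv i u) x * \<zeta> x \<partial>lborel)"
      by (rule integration_by_parts_compact_support[OF _ _ _ _ K])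
         (auto intro!: u2[OF i] test_function_differentiable[OF \<zeta>]
           test_function_continuous[OF \<zeta>1[OF i]] supp)
    ultimately show ?thesis by simp
  qed
  have "(\<integral>x. u x * laplacian \<zeta> x \<partial>lborel)
    = (\<Sum>i\<in>Basis. \<integral>x. u x * partial_deriv i (partial_deriv i \<zeta>) x \<partial>lborel)"
    unfolding laplacian_def sum_distrib_left
    by (intro Bochner_Integration.integral_sum integrable_continuous_compact_support[OF _ K])
       (auto intro!: continuous_on_mult ucont \<zeta>2 simp: supp2)
  also have "\<dots> = (\<Sum>i\<in>Basis. \<integral>x. partial_deriv i (partial_deriv i u) x * \<zeta> x \<partial>lborel)"
    using part by simp
  also have "\<dots> = (\<integral>x. laplacian u x * \<zeta> x \<partial>lborel)"
    unfolding laplacian_def sum_distrib_right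
    by (intro Bochner_Integration.integral_sum[symmetric] integrable_continuous_compact_support[OF _ K])
       (auto intro!: continuous_on_mult u2 \<zeta>0 simp: supp)
  finally show ?thesis .
qed

section \<open>The fundamental solution\<close>

lemma has_derivative_quadratic_powr:
  fixes x y :: "'a::euclidean_space"
  assumes "0 < c"
  shows "((\<lambda>x. (c + (x - y) \<bullet> (x - y)) powr a) has_derivative
    (\<lambda>v. 2 * a * ((x - y) \<bullet> v) * (c + (x - y) \<bullet> (x - y)) powr (a - 1))) (at x)"
proof -
  \<comment> \<open>The shift by \<open>c\<close> keeps the base away from 0, so the power is
    differentiable even at \<open>x = y\<close>.\<close>
  have pos: "0 < c + (x - y) \<bullet> (x - y)"
    using assms by (simp add: add_pos_nonneg)
  have "((\<lambda>x. c + (x - y) \<bullet> (x - y)) has_derivative (\<lambda>v. 2 * ((x - y) \<bullet> v))) (at x)"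
    by (auto intro!: derivative_eq_intros simp: inner_commute)
  from has_derivative_powr[OF this has_derivative_const pos, of a] show ?thesis
    using pos by (simp add: powr_diff field_simps)
qed

lemma partial_deriv_quadratic_powr:
  fixes y :: "'a::euclidean_space"
  assumes "0 < c"
  shows "partial_deriv v (\<lambda>x. (c + (x - y) \<bullet> (x - y)) powr a)
    = (\<lambda>x. 2 * a * ((x - y) \<bullet> v) * (c + (x - y) \<bullet> (x - y)) powr (a - 1))"
  using partial_deriv_eqI[OF has_derivative_quadratic_powr[OF assms]] by blast

lemma has_derivative_partial_quadratic_powr:
  fixes x y :: "'a::euclidean_space"
  assumes "0 < c"
  shows "((\<lambda>x. 2 * a * ((x - y) \<bullet> v) * (c + (x - y) \<bullet> (x - y)) powr (a - 1)) has_derivative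
    (\<lambda>w. 2 * a * (w \<bullet> v) * (c + (x - y) \<bullet> (x - y)) powr (a - 1)
      + 4 * a * (a - 1) * ((x - y) \<bullet> v) * ((x - y) \<bullet> w) * (c + (x - y) \<bullet> (x - y)) powr (a - 2))) (at x)"
  by (rule derivative_eq_intros has_derivative_quadratic_powr[OF assms] refl | simp add: algebra_simps)+

lemma partial_deriv2_quadratic_powr:
  fixes y :: "'a::euclidean_space"
  assumes "0 < c"
  shows "partial_deriv w (partial_deriv v (\<lambda>x. (c + (x - y) \<bullet> (x - y)) powr a))
    = (\<lambda>x. 2 * a * (w \<bullet> v) * (c + (x - y) \<bullet> (x - y)) powr (a - 1)
      + 4 * a * (a - 1) * ((x - y) \<bullet> v) * ((x - y) \<bullet> w) * (c + (x - y) \<bullet> (x - y)) powr (a - 2))"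
  unfolding partial_deriv_quadratic_powr[OF assms]
  using partial_deriv_eqI[OF has_derivative_partial_quadratic_powr[OF assms]] by blast

lemma continuous_on_quadratic_powr:
  fixes y :: "'a::euclidean_space"
  assumes "0 < c"
  shows "continuous_on UNIV (\<lambda>x. (c + (x - y) \<bullet> (x - y)) powr a)"
  using assms by (intro continuous_intros) (simp add: add_pos_nonneg less_imp_neq[symmetric])

lemma Ck2_quadratic_powr:
  fixes y :: "'a::euclidean_space"
  assumes "0 < c"
  shows "Ck 2 (\<lambda>x. (c + (x - y) \<bullet> (x - y)) powr a)"
proof -
  let ?u = "\<lambda>x. (c + (x - y) \<bullet> (x - y)) powr a"
  have "?u differentiable (at x)" for x
    using has_derivative_quadratic_powr[OF assms] unfolding differentiable_def by blast
  moreover have "partial_deriv v ?u differentiable (at x)" for v x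
    unfolding partial_deriv_quadratic_powr[OF assms] differentiable_def
    using has_derivative_partial_quadratic_powr[OF assms] by blast
  moreover have "continuous_on UNIV (partial_deriv w (partial_deriv v ?u))" for v w
    unfolding partial_deriv2_quadratic_powr[OF assms]
    by (intro continuous_intros continuous_on_quadratic_powr[OF assms])
  ultimately show ?thesis by (simp add: numeral_2_eq_2)
qed

text \<open>Write \<open>t\<close> for the base and \<open>a\<close> for the exponent. Since
  \<open>|x - y|\<close> squared is \<open>t - c\<close>, the terms without the factor
  \<open>c\<close> add up to \<open>2 * a * (d + 2 * (a - 1)) * t powr (a - 1)\<close>, which
  vanishes exactly because \<open>a = (2 - d) / 2\<close>. Only the contribution of
  \<open>- c\<close> survives.\<close>

lemma laplacian_regularized_newton_kernel:
  fixes x y :: "'a::euclidean_space"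
  assumes "0 < c"
  defines "d \<equiv> real DIM('a)"
  shows "laplacian (\<lambda>x. (c + (x - y) \<bullet> (x - y)) powr ((2 - d) / 2)) x
    = - (d * (d - 2) * c * (c + (x - y) \<bullet> (x - y)) powr (- (d + 2) / 2))"
proof -
  define a where "a = (2 - d) / 2"
  define t where "t = c + (x - y) \<bullet> (x - y)"
  have t: "0 < t" using assms by (simp add: t_def add_pos_nonneg)
  have sq: "(\<Sum>i\<in>Basis. ((x - y) \<bullet> i) * ((x - y) \<bullet> i)) = t - c"
    by (simp add: t_def euclidean_inner[of "x - y" "x - y"])
  have "laplacian (\<lambda>x. (c + (x - y) \<bullet> (x - y)) powr a) x
    = (\<Sum>i\<in>(Basis::'a set). 2 * a * t powr (a - 1)
        + 4 * a * (a - 1) * t powr (a - 2) * (((x - y) \<bullet> i) * ((x - y) \<bullet> i)))"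
    unfolding laplacian_def partial_deriv2_quadratic_powr[OF assms(1)]
    by (intro sum.cong) (simp_all add: t_def inner_Basis mult_ac)
  also have "\<dots> = d * (2 * a * t powr (a - 1)) + 4 * a * (a - 1) * t powr (a - 2) * (t - c)"
    by (simp only: sum.distrib sum_constant sq flip: sum_distrib_left) (simp add: d_def)
  also have "t powr (a - 1) = t * t powr (a - 2)"
    using t by (simp add: powr_mult_base)
  also have "d * (2 * a * (t * t powr (a - 2))) + 4 * a * (a - 1) * t powr (a - 2) * (t - c)
    = - (d * (d - 2) * c * t powr (a - 2))"
    by (simp add: a_def field_simps)
  also have "a - 2 = - (d + 2) / 2"
    by (simp add: a_def field_simps)
  finally show ?thesis by (simp add: t_def a_def)
qed

section \<open>Integrability of the approximate identity and of the Newton kernel\<close>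

lemma power2_powr: "0 < (t::real) \<Longrightarrow> t\<^sup>2 powr (s / 2) = t powr s"
  using powr_powr[of t 2 "s / 2"] by simp

text \<open>The function is at most 1 on the unit ball and at most \<open>norm z\<close> to the
  power \<open>-(d + 2)\<close> outside. There the shell estimate applies with weight 1, whose mass
  on balls grows with exponent \<open>d\<close>.\<close>

lemma integrable_one_plus_norm_sq_powr:
  "integrable lborel (\<lambda>z::'a::euclidean_space. (1 + z \<bullet> z) powr (- (real DIM('a) + 2) / 2))"
proof (rule integrableI_nonneg)
  let ?d = "real DIM('a)"
  let ?f = "\<lambda>z::'a. (1 + z \<bullet> z) powr (- (?d + 2) / 2)"
  have [measurable]: "?f \<in> borel_measurable borel"
    using continuous_on_quadratic_powr[of 1 "0::'a"] borel_measurable_continuous_onI by fastforce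
  then show "?f \<in> borel_measurable lborel" by simp
  have bnd: "ennreal (?f z) \<le> indicator (ball 0 1) z
      + recip_powr (norm (0 - z)) (?d + 2) * 1 * indicator (- ball 0 1) z" for z :: 'a
  proof (cases "z \<in> ball 0 1")
    case True
    have "?f z \<le> 1 powr (- (?d + 2) / 2)"
      by (intro powr_mono2') auto
    with True show ?thesis by (simp add: ennreal_le_1)
  next
    case False
    then have z: "0 < norm z" by auto
    have "?f z \<le> (norm z ^ 2) powr (- (?d + 2) / 2)"
      using z by (intro powr_mono2') (auto simp: power2_norm_eq_inner)
    also have "\<dots> = norm z powr - (?d + 2)"
      using z by (simp add: power2_powr)
    finally show ?thesis using False z by (auto simp: recip_powr_pos intro!: ennreal_leI)
  qed
  have ball: "(\<integral>\<^sup>+z\<in>ball (0::'a) r. 1 \<partial>lborel) \<le> ennreal (unit_ball_vol ?d * r powr ?d)"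
    if "1 \<le> r" for r
    using that by (simp add: emeasure_ball powr_realpow)
  have "(\<integral>\<^sup>+z. ennreal (?f z) \<partial>lborel) \<le> (\<integral>\<^sup>+z. indicator (ball 0 1) z
      + recip_powr (norm (0 - z)) (?d + 2) * 1 * indicator (- ball 0 1) (z::'a) \<partial>lborel)"
    by (intro nn_integral_mono bnd)
  also have "\<dots> = emeasure lborel (ball (0::'a) 1)
      + (\<integral>\<^sup>+z\<in>- ball 0 1. recip_powr (norm ((0::'a) - z)) (?d + 2) * 1 \<partial>lborel)"
    by (subst nn_integral_add) (auto intro!: borel_measurable_indicator)
  also have "\<dots> < \<infinity>"
  proof -
    have "(\<integral>\<^sup>+z\<in>- ball 0 1. recip_powr (norm ((0::'a) - z)) (?d + 2) * 1 \<partial>lborel) < \<infinity>"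
      by (rule le_less_trans[OF nn_integral_recip_powr_outside_ball[where \<gamma> = ?d and C = "unit_ball_vol ?d"]])
         (use ball in auto)
    then show ?thesis by (simp add: emeasure_ball)
  qed
  finally show "(\<integral>\<^sup>+z. ennreal (?f z) \<partial>lborel) < \<infinity>" .
qed auto

text \<open>The singularity has order \<open>d - 2\<close>, which is below the dimension, and
  \<open>w\<close> is bounded and supported in a ball about \<open>y\<close>.\<close>

lemma integrable_newton_kernel_times:
  fixes w :: "'a::euclidean_space \<Rightarrow> real"
  assumes d: "DIM('a) \<ge> 2" and w: "continuous_on UNIV w" "compact K" "\<And>x. x \<notin> K \<Longrightarrow> w x = 0"
  shows "integrable lborel (\<lambda>x. norm (x - y) powr (2 - real DIM('a)) * w x)"
proof (rule integrableI_bounded)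
  let ?d = "real DIM('a)"
  have [measurable]: "w \<in> borel_measurable borel"
    using w(1) by (rule borel_measurable_continuous_onI)
  show "(\<lambda>x. norm (x - y) powr (2 - ?d) * w x) \<in> borel_measurable lborel" by simp
  obtain M where M: "0 < M" "\<And>x. \<bar>w x\<bar> \<le> M"
    using bounded_continuous_compact_support[OF w] by blast
  obtain R where R: "0 < R" "K \<subseteq> ball y R"
    using bounded_subset_ballD[OF compact_imp_bounded[OF w(2)], of y] by auto
  have "(\<integral>\<^sup>+x. ennreal (norm (norm (x - y) powr (2 - ?d) * w x)) \<partial>lborel)
    \<le> (\<integral>\<^sup>+x. ennreal M * (recip_powr (norm (y - x)) (?d - 2) * indicator (ball y R) x) \<partial>lborel)"
  proof (rule nn_integral_mono)
    fix x
    show "ennreal (norm (norm (x - y) powr (2 - ?d) * w x))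
      \<le> ennreal M * (recip_powr (norm (y - x)) (?d - 2) * indicator (ball y R) x)"
    proof (cases "x \<in> ball y R \<and> x \<noteq> y")
      case True
      have "norm (norm (x - y) powr (2 - ?d) * w x) \<le> M * norm (y - x) powr - (?d - 2)"
        using M(2)[of x] by (simp add: norm_minus_commute abs_mult mult.commute mult_right_mono)
      then have "ennreal (norm (norm (x - y) powr (2 - ?d) * w x)) \<le> ennreal (M * norm (y - x) powr - (?d - 2))"
        by (rule ennreal_leI)
      also have "\<dots> = ennreal M * (recip_powr (norm (y - x)) (?d - 2) * indicator (ball y R) x)"
        using True M(1) recip_powr_pos[of "norm (y - x)" "?d - 2"] by (auto simp: ennreal_mult')
      finally show ?thesis .
    next
      \<comment> \<open>At \<open>x = y\<close> the left side is 0 because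
        \<open>0 powr s = 0\<close>; outside the ball \<open>w\<close> vanishes.\<close>
      case False
      then show ?thesis using subsetD[OF R(2), of x] w(3)[of x] by (cases "x = y"; cases "x \<in> K") auto
    qed
  qed
  also have "\<dots> = ennreal M * (\<integral>\<^sup>+x\<in>ball y R. recip_powr (norm (y - x)) (?d - 2) \<partial>lborel)"
    by (rule nn_integral_cmult) (auto intro!: borel_measurable_times_ennreal borel_measurable_indicator)
  also have "\<dots> < \<infinity>"
    using le_less_trans[OF nn_integral_recip_powr_ball[of R "?d - 2" y] ennreal_less_top] d R
    by (simp add: ennreal_mult_less_top)
  finally show "(\<integral>\<^sup>+x. ennreal (norm (norm (x - y) powr (2 - ?d) * w x)) \<partial>lborel) < \<infinity>" .
qed

lemma integral_lborel_rescale: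
  fixes f :: "'a::euclidean_space \<Rightarrow> real"
  assumes [measurable]: "f \<in> borel_measurable borel" and c: "0 < c"
  shows "(\<integral>x. f x \<partial>lborel) = (\<integral>z. c ^ DIM('a) * f (y + c *\<^sub>R z) \<partial>lborel)"
proof -
  have "(\<integral>x. f x \<partial>lborel)
    = (\<integral>x. f x \<partial>density (distr lborel borel (\<lambda>x. y + c *\<^sub>R x)) (\<lambda>_. ennreal (c ^ DIM('a))))"
    using lborel_affine[of c y] c by simp
  also have "\<dots> = (\<integral>x. c ^ DIM('a) * f x \<partial>distr lborel borel (\<lambda>x. y + c *\<^sub>R x))"
    using c by (subst integral_density) auto
  also have "\<dots> = (\<integral>z. c ^ DIM('a) * f (y + c *\<^sub>R z) \<partial>lborel)"
    by (subst integral_distr) auto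
  finally show ?thesis .
qed

text \<open>The total mass of minus the Laplacian of \<open>(1 + |z|\<^sup>2)\<close> to the power \<open>(2 - d) / 2\<close>.\<close>
definition newton_const :: "'a::euclidean_space itself \<Rightarrow> real" where
  "newton_const _ = real DIM('a) * (real DIM('a) - 2) *
     (\<integral>z. (1 + z \<bullet> z) powr (- (real DIM('a) + 2) / 2) \<partial>(lborel :: 'a measure))"

text \<open>A nonnegative integrable function with integral 0 vanishes almost everywhere, but this
  integrand is positive everywhere. The factor \<open>d - 2\<close> is positive in dimension at
  least 3.\<close>

lemma newton_const_pos:
  assumes "DIM('a::euclidean_space) \<ge> 3"
  shows "0 < newton_const TYPE('a)"
proof -
  let ?f = "\<lambda>z::'a. (1 + z \<bullet> z) powr (- (real DIM('a) + 2) / 2)"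
  have pos: "0 < ?f z" for z
    using inner_ge_zero[of z] by (simp add: add_pos_nonneg less_imp_neq[symmetric])
  have "(\<integral>z. ?f z \<partial>lborel) \<noteq> 0"
  proof
    assume "(\<integral>z. ?f z \<partial>lborel) = 0"
    then have "AE z in lborel. ?f z = 0"
      using integral_nonneg_eq_0_iff_AE[OF integrable_one_plus_norm_sq_powr] by auto
    then have "AE z in lborel. (z::'a) \<notin> UNIV"
      by eventually_elim (use pos in \<open>simp add: less_imp_neq[symmetric]\<close>)
    then have "emeasure lborel (UNIV :: 'a set) = 0"
      using AE_iff_measurable[of UNIV lborel "\<lambda>z::'a. z \<notin> UNIV"] by simp
    then show False by simp
  qed
  moreover have "0 \<le> (\<integral>z. ?f z \<partial>lborel)" by simp
  ultimately have "0 < (\<integral>z. ?f z \<partial>lborel)" by linarith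
  then show ?thesis
    unfolding newton_const_def using assms by (intro mult_pos_pos) auto
qed

text \<open>For each \<open>n\<close>, Green's identity moves the Laplacian onto the smooth kernel
  \<open>G n\<close>, and the substitution \<open>x = y + e n *\<^sub>R z\<close> turns the result
  into an average of \<open>\<zeta>\<close> near \<open>y\<close> against the fixed profile
  \<open>\<psi>\<close>. Computing the limit of the same sequence before and after this
  transformation, by dominated convergence, gives the two sides.\<close>

lemma newton_kernel_fundamental_solution:
  fixes \<zeta> :: "'a::euclidean_space \<Rightarrow> real"
  assumes d: "DIM('a) \<ge> 2" and \<zeta>: "test_function \<zeta>"
  shows "(\<integral>x. norm (x - y) powr (2 - real DIM('a)) * laplacian \<zeta> x \<partial>lborel)
    = - newton_const TYPE('a) * \<zeta> y"
proof -
  let ?d = "real DIM('a)"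
  define e where "e n = 1 / real (Suc n)" for n
  have e: "0 < e n" for n by (simp add: e_def)
  have e0: "e \<longlonglongrightarrow> 0"
    unfolding e_def using LIMSEQ_inverse_real_of_nat by (simp add: inverse_eq_divide del: of_nat_Suc)
  define G where "G n x = ((e n)\<^sup>2 + (x - y) \<bullet> (x - y)) powr ((2 - ?d) / 2)" for n x
  define \<psi> where "\<psi> z = (1 + z \<bullet> z) powr (- (?d + 2) / 2)" for z :: 'a
  obtain K where K: "compact K" and supp: "\<And>x. x \<notin> K \<Longrightarrow> \<zeta> x = 0"
    using test_function_support[OF \<zeta>] by blast
  note lcont = test_function_laplacian_continuous[OF \<zeta>]
  have lsupp: "laplacian \<zeta> x = 0" if "x \<notin> K" for x
    using laplacian_eq_0_outside_support[OF compact_imp_closed[OF K] supp that] .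
  obtain M where M: "0 < M" "\<And>x. \<bar>\<zeta> x\<bar> \<le> M"
    using bounded_continuous_compact_support[OF test_function_continuous[OF \<zeta>] K supp] by blast
  have [measurable]: "laplacian \<zeta> \<in> borel_measurable borel" "\<zeta> \<in> borel_measurable borel"
    using lcont test_function_continuous[OF \<zeta>] by (auto intro: borel_measurable_continuous_onI)
  have [measurable]: "G n \<in> borel_measurable borel" for n
    unfolding G_def using e[of n] by (intro borel_measurable_continuous_onI continuous_on_quadratic_powr) simp
  have [measurable]: "\<psi> \<in> borel_measurable borel"
    using borel_measurable_integrable[OF integrable_one_plus_norm_sq_powr] unfolding \<psi>_def[abs_def] by simp

  have "(\<lambda>n. \<integral>x. G n x * laplacian \<zeta> x \<partial>lborel)
      \<longlonglongrightarrow> (\<integral>x. norm (x - y) powr (2 - ?d) * laplacian \<zeta> x \<partial>lborel)"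
  proof (rule integral_dominated_convergence)
    \<comment> \<open>The exponent \<open>(2 - d) / 2\<close> is not positive, so adding
      \<open>e n\<close> squared to the base only decreases the kernel: the singular kernel itself
      dominates.\<close>
    show "integrable lborel (\<lambda>x. norm (x - y) powr (2 - ?d) * \<bar>laplacian \<zeta> x\<bar>)"
      using lsupp by (intro integrable_newton_kernel_times[OF d _ K] continuous_intros lcont) auto
    \<comment> \<open>The point \<open>y\<close> is excluded since \<open>0 powr (2 - d)\<close> is
      0 there, whereas \<open>G n y\<close> is positive; it is a null set.\<close>
    have lim: "(\<lambda>n. G n x * laplacian \<zeta> x) \<longlonglongrightarrow> norm (x - y) powr (2 - ?d) * laplacian \<zeta> x"
      and bnd: "norm (G n x * laplacian \<zeta> x) \<le> norm (x - y) powr (2 - ?d) * \<bar>laplacian \<zeta> x\<bar>"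
      if "x \<noteq> y" for n x
    proof -
      have sq: "((x - y) \<bullet> (x - y)) powr ((2 - ?d) / 2) = norm (x - y) powr (2 - ?d)"
        using that by (simp add: power2_powr flip: power2_norm_eq_inner)
      have "(\<lambda>n. G n x) \<longlonglongrightarrow> (0\<^sup>2 + (x - y) \<bullet> (x - y)) powr ((2 - ?d) / 2)"
        unfolding G_def using that by (intro tendsto_intros e0) auto
      then show "(\<lambda>n. G n x * laplacian \<zeta> x) \<longlonglongrightarrow> norm (x - y) powr (2 - ?d) * laplacian \<zeta> x"
        by (intro tendsto_intros) (simp add: sq)
      have "G n x \<le> ((x - y) \<bullet> (x - y)) powr ((2 - ?d) / 2)"
        unfolding G_def using that d by (intro powr_mono2') auto
      then show "norm (G n x * laplacian \<zeta> x) \<le> norm (x - y) powr (2 - ?d) * \<bar>laplacian \<zeta> x\<bar>"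
        by (simp add: sq abs_mult mult_right_mono G_def)
    qed
    show "AE x in lborel. (\<lambda>n. G n x * laplacian \<zeta> x) \<longlonglongrightarrow> norm (x - y) powr (2 - ?d) * laplacian \<zeta> x"
      using AE_lborel_singleton[of y] by eventually_elim (rule lim)
    show "AE x in lborel. norm (G n x * laplacian \<zeta> x) \<le> norm (x - y) powr (2 - ?d) * \<bar>laplacian \<zeta> x\<bar>" for n
      using AE_lborel_singleton[of y] by eventually_elim (rule bnd)
  qed measurable

  moreover have "(\<integral>x. G n x * laplacian \<zeta> x \<partial>lborel)
      = - (?d * (?d - 2)) * (\<integral>z. \<psi> z * \<zeta> (y + e n *\<^sub>R z) \<partial>lborel)" for n
  proof -
    have "Ck 2 (G n)"
      unfolding G_def using e[of n] by (intro Ck2_quadratic_powr) simp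
    then have "(\<integral>x. G n x * laplacian \<zeta> x \<partial>lborel) = (\<integral>x. laplacian (G n) x * \<zeta> x \<partial>lborel)"
      by (rule green_test_function[OF \<zeta>])
    also have "\<dots> = (\<integral>x. - (?d * (?d - 2)) *
        ((e n)\<^sup>2 * ((e n)\<^sup>2 + (x - y) \<bullet> (x - y)) powr (- (?d + 2) / 2) * \<zeta> x) \<partial>lborel)"
      unfolding G_def using e[of n] by (subst laplacian_regularized_newton_kernel) (simp_all add: mult_ac)
    also have "\<dots> = - (?d * (?d - 2)) *
        (\<integral>x. (e n)\<^sup>2 * ((e n)\<^sup>2 + (x - y) \<bullet> (x - y)) powr (- (?d + 2) / 2) * \<zeta> x \<partial>lborel)"
      by (rule integral_mult_right_zero)
    also have "(\<integral>x. (e n)\<^sup>2 * ((e n)\<^sup>2 + (x - y) \<bullet> (x - y)) powr (- (?d + 2) / 2) * \<zeta> x \<partial>lborel)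
      = (\<integral>z. e n ^ DIM('a) * ((e n)\<^sup>2 * ((e n)\<^sup>2 + (y + e n *\<^sub>R z - y) \<bullet> (y + e n *\<^sub>R z - y)) powr (- (?d + 2) / 2)
          * \<zeta> (y + e n *\<^sub>R z)) \<partial>lborel)"
    proof (rule integral_lborel_rescale[OF _ e])
      have "(\<lambda>x. ((e n)\<^sup>2 + (x - y) \<bullet> (x - y)) powr (- (?d + 2) / 2)) \<in> borel_measurable borel"
        using e[of n] by (intro borel_measurable_continuous_onI continuous_on_quadratic_powr) simp
      then show "(\<lambda>x. (e n)\<^sup>2 * ((e n)\<^sup>2 + (x - y) \<bullet> (x - y)) powr (- (?d + 2) / 2) * \<zeta> x) \<in> borel_measurable borel"
        by simp
    qed
    also have "\<dots> = (\<integral>z. \<psi> z * \<zeta> (y + e n *\<^sub>R z) \<partial>lborel)"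
    proof (rule Bochner_Integration.integral_cong[OF refl])
      fix z :: 'a
      have "(e n)\<^sup>2 + (y + e n *\<^sub>R z - y) \<bullet> (y + e n *\<^sub>R z - y) = (e n)\<^sup>2 * (1 + z \<bullet> z)"
        by (simp add: power2_eq_square algebra_simps)
      moreover have "((e n)\<^sup>2 * (1 + z \<bullet> z)) powr (- (?d + 2) / 2)
          = e n powr - (?d + 2) * \<psi> z"
        using e[of n] by (simp add: \<psi>_def powr_mult power2_powr)
      \<comment> \<open>The Jacobian and the factor \<open>c\<close> of the Laplacian cancel the
        scaling of the power exactly, so the total mass does not depend on \<open>n\<close>.\<close>
      moreover have "e n ^ DIM('a) * (e n)\<^sup>2 * e n powr - (?d + 2) = 1"
      proof -
        have "e n ^ DIM('a) * (e n)\<^sup>2 = e n powr (?d + 2)"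
          using e[of n] powr_realpow[of "e n" "DIM('a) + 2"]
          by (simp add: power2_eq_square ac_simps)
        then show ?thesis using e[of n] by (simp flip: powr_add)
      qed
      ultimately show "e n ^ DIM('a) * ((e n)\<^sup>2 * ((e n)\<^sup>2 + (y + e n *\<^sub>R z - y) \<bullet> (y + e n *\<^sub>R z - y)) powr (- (?d + 2) / 2)
          * \<zeta> (y + e n *\<^sub>R z)) = \<psi> z * \<zeta> (y + e n *\<^sub>R z)"
        by (metis (no_types, lifting) mult.assoc mult.left_neutral)
    qed
    finally show ?thesis .
  qed
  moreover have "(\<lambda>n. \<integral>z. \<psi> z * \<zeta> (y + e n *\<^sub>R z) \<partial>lborel) \<longlonglongrightarrow> (\<integral>z. \<psi> z * \<zeta> y \<partial>lborel)"
  proof (rule integral_dominated_convergence)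
    show "integrable lborel (\<lambda>z. \<psi> z * M)"
      unfolding \<psi>_def by (intro integrable_mult_left integrable_one_plus_norm_sq_powr)
    show "AE z in lborel. (\<lambda>n. \<psi> z * \<zeta> (y + e n *\<^sub>R z)) \<longlonglongrightarrow> \<psi> z * \<zeta> y"
    proof (intro AE_I2 tendsto_mult_left)
      fix z :: 'a
      have "isCont \<zeta> y"
        using test_function_continuous[OF \<zeta>] continuous_on_eq_continuous_at by blast
      moreover have "(\<lambda>n. y + e n *\<^sub>R z) \<longlonglongrightarrow> y + 0 *\<^sub>R z"
        by (intro tendsto_intros e0)
      ultimately show "(\<lambda>n. \<zeta> (y + e n *\<^sub>R z)) \<longlonglongrightarrow> \<zeta> y"
        by (auto intro: isCont_tendsto_compose)
    qed
    show "AE z in lborel. norm (\<psi> z * \<zeta> (y + e n *\<^sub>R z)) \<le> \<psi> z * M" for n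
      using M by (auto simp: abs_mult \<psi>_def intro!: mult_left_mono)
  qed measurable
  ultimately have "(\<lambda>n. - (?d * (?d - 2)) * (\<integral>z. \<psi> z * \<zeta> (y + e n *\<^sub>R z) \<partial>lborel))
      \<longlonglongrightarrow> (\<integral>x. norm (x - y) powr (2 - ?d) * laplacian \<zeta> x \<partial>lborel)"
    and "(\<lambda>n. - (?d * (?d - 2)) * (\<integral>z. \<psi> z * \<zeta> (y + e n *\<^sub>R z) \<partial>lborel))
      \<longlonglongrightarrow> - (?d * (?d - 2)) * (\<integral>z. \<psi> z * \<zeta> y \<partial>lborel)"
    by (simp_all only: tendsto_mult_left)
  then have "(\<integral>x. norm (x - y) powr (2 - ?d) * laplacian \<zeta> x \<partial>lborel)
      = - (?d * (?d - 2)) * (\<integral>z. \<psi> z * \<zeta> y \<partial>lborel)"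
    using LIMSEQ_unique by blast
  then show ?thesis
    by (simp add: newton_const_def \<psi>_def mult_ac)
qed

section \<open>Potentials of singular weights\<close>

lemma power2_times_powr: "0 < (s::real) \<Longrightarrow> c = b + 2 \<Longrightarrow> s\<^sup>2 * s powr b = s powr c"
  by (simp add: powr_add)

text \<open>The summands come from the ball of radius \<open>\<rho>(x) / 2\<close> and from its complement; the factor
  \<open>3 powr \<beta>\<close> from recentering balls at the nearest point of \<open>K\<close>.\<close>
definition potential_upper_const :: "real \<Rightarrow> real \<Rightarrow> real \<Rightarrow> real" where
  "potential_upper_const d \<beta> a =
     (2 powr (d - 2) * unit_ball_vol d / (1 - 2 powr - 2)
       + 2 powr \<beta> / (1 - 2 powr (\<beta> - (d - 2))) * (a * 3 powr \<beta>)) * 2 powr (d - 2 - \<beta>)"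

text \<open>This isolates what the hypotheses say about \<open>K = - \<Omega>\<close>. The bound is
  the supremum condition multiplied out by \<open>r powr \<beta>\<close>, with the finite constant
  taken as a real number \<open>a\<close>.\<close>

locale singular_weight =
  fixes K :: "'a::euclidean_space set" and \<beta> a :: real
  assumes dim: "DIM('a) \<ge> 3" and closed_K: "closed K" and nonempty_K: "K \<noteq> {}"
    and beta: "\<beta> < real DIM('a) - 2" and a_nonneg: "0 \<le> a"
    and weight_bound: "\<And>p r. p \<in> K \<Longrightarrow> 0 < r \<Longrightarrow>
      (\<integral>\<^sup>+y\<in>ball p r. recip_powr (infdist y K) (real DIM('a) - \<beta>) \<partial>lborel) \<le> ennreal (a * r powr \<beta>)"
begin

abbreviation w :: "'a \<Rightarrow> ennreal" where
  "w y \<equiv> recip_powr (infdist y K) (real DIM('a) - \<beta>)"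

abbreviation \<Phi> :: "'a \<Rightarrow> ennreal" where
  "\<Phi> x \<equiv> (\<integral>\<^sup>+y. recip_powr (norm (x - y)) (real DIM('a) - 2) * w y \<partial>lborel)"

lemma measurable_infdist_K [measurable]: "(\<lambda>y. infdist y K) \<in> borel_measurable borel"
  by (intro borel_measurable_continuous_onI continuous_intros)

lemma measurable_potential [measurable]: "\<Phi> \<in> borel_measurable borel"
proof -
  have "\<Phi> \<in> borel_measurable lborel"
    by (rule lborel.borel_measurable_nn_integral) measurable
  then show ?thesis by simp
qed

lemma infdist_le_add_dist: "infdist y K \<le> infdist x K + dist x y"
  using infdist_triangle[of y K x] by (simp add: dist_commute)

text \<open>On \<open>ball x s\<close> the kernel is at least \<open>s\<close> to the power
  \<open>-(d - 2)\<close> and the weight at least \<open>infdist x K + s\<close> to the power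
  \<open>\<beta> - d\<close>; the volume of the ball turns the first factor into a multiple of
  \<open>s\<close> squared.\<close>

lemma potential_ge_ball:
  assumes "0 < s"
  shows "ennreal (unit_ball_vol (real DIM('a)) * s\<^sup>2 * (infdist x K + s) powr (\<beta> - real DIM('a))) \<le> \<Phi> x"
proof -
  have pos: "0 < infdist x K + s"
    using assms infdist_nonneg[of x K] by linarith
  have "ennreal (unit_ball_vol (real DIM('a)) * s\<^sup>2 * (infdist x K + s) powr (\<beta> - real DIM('a)))
    = ennreal (s powr - (real DIM('a) - 2)) * ennreal ((infdist x K + s) powr - (real DIM('a) - \<beta>)) * emeasure lborel (ball x s)"
  proof -
    have "s powr - (real DIM('a) - 2) * s ^ DIM('a) = s\<^sup>2"
      using assms by (simp add: powr_add[symmetric] flip: powr_realpow[of s "DIM('a)"])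
    then show ?thesis
      using assms by (simp add: emeasure_ball ennreal_mult[symmetric] mult_ac)
  qed
  also have "\<dots> = (\<integral>\<^sup>+y\<in>ball x s. recip_powr s (real DIM('a) - 2) * recip_powr (infdist x K + s) (real DIM('a) - \<beta>) \<partial>lborel)"
    using assms pos by (simp add: recip_powr_pos nn_integral_cmult_indicator)
  also have "\<dots> \<le> \<Phi> x"
  proof (intro nn_integral_mono)
    fix y
    show "recip_powr s (real DIM('a) - 2) * recip_powr (infdist x K + s) (real DIM('a) - \<beta>) * indicator (ball x s) y
      \<le> recip_powr (norm (x - y)) (real DIM('a) - 2) * w y"
    proof (cases "y \<in> ball x s")
      case True
      then have "recip_powr s (real DIM('a) - 2) \<le> recip_powr (norm (x - y)) (real DIM('a) - 2)"
        using dim by (intro recip_powr_antimono) (auto simp: dist_norm)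
      moreover have "recip_powr (infdist x K + s) (real DIM('a) - \<beta>) \<le> w y"
        using True infdist_le_add_dist[of y x] beta by (intro recip_powr_antimono) (auto simp: infdist_nonneg)
      ultimately show ?thesis using True by (simp add: mult_mono)
    qed simp
  qed
  finally show ?thesis .
qed

lemma potential_lower_bound:
  "ennreal (unit_ball_vol (real DIM('a)) * 2 powr (\<beta> - real DIM('a))) * recip_powr (infdist x K) (real DIM('a) - 2 - \<beta>) \<le> \<Phi> x"
proof (cases "infdist x K = 0")
  case False
  define R where "R = infdist x K"
  have R: "0 < R"
    using False infdist_nonneg[of x K] by (simp add: R_def)
  \<comment> \<open>The ball radius is the distance to \<open>K\<close> itself; the doubled distance
    produces \<open>2 powr (\<beta> - d)\<close>.\<close>
  have "R\<^sup>2 * (R + R) powr (\<beta> - real DIM('a)) = 2 powr (\<beta> - real DIM('a)) * R powr - (real DIM('a) - 2 - \<beta>)"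
    using R power2_times_powr[of R "- (real DIM('a) - 2 - \<beta>)" "\<beta> - real DIM('a)"]
    by (simp add: powr_mult flip: mult_2)
  then show ?thesis
    using potential_ge_ball[OF R, of x] R unfolding R_def[symmetric]
    by (simp add: recip_powr_pos mult.assoc flip: ennreal_mult')
next
  case True
  define q where "q = real DIM('a) - 2 - \<beta>"
  have q: "0 < q" using beta by (simp add: q_def)
  have ge: "ennreal (unit_ball_vol (real DIM('a)) * s powr - q) \<le> \<Phi> x" if "0 < s" for s
  proof -
    have "s\<^sup>2 * s powr (\<beta> - real DIM('a)) = s powr - q"
      using that by (intro power2_times_powr) (simp_all add: q_def)
    then show ?thesis
      using potential_ge_ball[OF that, of x] True by (simp add: mult.assoc)
  qed
  have "\<Phi> x = \<infinity>"
  proof (rule ccontr)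
    assume "\<Phi> x \<noteq> \<infinity>"
    then obtain M where M: "0 \<le> M" "\<Phi> x = ennreal M"
      by (cases "\<Phi> x") auto
    have v: "0 < unit_ball_vol (real DIM('a))" by simp
    \<comment> \<open>This radius makes the lower bound equal to \<open>M + 1\<close>, which
      contradicts the value \<open>M\<close>; solving for \<open>s\<close> requires \<open>q\<close>
      to be nonzero.\<close>
    define s where "s = ((M + 1) / unit_ball_vol (real DIM('a))) powr (- 1 / q)"
    have "0 < s" using M v by (simp add: s_def add_nonneg_pos less_imp_neq[symmetric])
    moreover have "s powr - q = (M + 1) / unit_ball_vol (real DIM('a))"
      using q M v by (simp add: s_def powr_powr)
    ultimately have "ennreal (M + 1) \<le> ennreal M"
      using ge[of s] M v by simp
    then show False using M by simp
  qed
  then show ?thesis by simp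
qed

lemma two_powr_less_1: "2 powr (\<beta> - (real DIM('a) - 2)) < 1"
  using beta by (intro powr_less_one) auto

lemma potential_upper_bound:
  "\<Phi> x \<le> ennreal (potential_upper_const (real DIM('a)) \<beta> a) * recip_powr (infdist x K) (real DIM('a) - 2 - \<beta>)"
proof (cases "infdist x K = 0")
  case True
  \<comment> \<open>The right side is meant to be infinite here, but
    \<open>0 * \<infinity> = 0\<close> in \<open>ennreal\<close>, so the constant must be strictly
    positive.\<close>
  have "0 < potential_upper_const (real DIM('a)) \<beta> a"
    unfolding potential_upper_const_def using two_powr_less_1 a_nonneg
    by (intro mult_pos_pos add_pos_nonneg divide_pos_pos divide_nonneg_nonneg mult_nonneg_nonneg)
       (auto simp: powr_minus_divide)
  then show ?thesis using True by (simp add: ennreal_mult_top)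
next
  case False
  define R where "R = infdist x K / 2"
  have R: "0 < R" "infdist x K = 2 * R"
    using False infdist_nonneg[of x K] by (simp_all add: R_def)
  obtain p where p: "p \<in> K" "infdist x K = dist x p"
    using infdist_attains_inf[OF closed_K nonempty_K] by blast
  let ?f = "\<lambda>y. recip_powr (norm (x - y)) (real DIM('a) - 2)"
  let ?N = "2 powr (real DIM('a) - 2) * unit_ball_vol (real DIM('a)) / (1 - 2 powr - 2)"
  let ?F = "2 powr \<beta> / (1 - 2 powr (\<beta> - (real DIM('a) - 2))) * (a * 3 powr \<beta>)"
  have nonneg: "0 \<le> ?N" "0 \<le> ?F"
    using two_powr_less_1 a_nonneg
    by (auto simp: powr_minus_divide intro!: divide_nonneg_nonneg mult_nonneg_nonneg)
  \<comment> \<open>Points of \<open>ball x R\<close> stay at distance at least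
    \<open>2 * R - R\<close> from \<open>K\<close>, so the weight is at most
    \<open>R powr (\<beta> - d)\<close>; the kernel alone integrates to a multiple of
    \<open>R\<close> squared.\<close>
  have near: "(\<integral>\<^sup>+y\<in>ball x R. ?f y * w y \<partial>lborel) \<le> ennreal (?N * R powr (\<beta> - (real DIM('a) - 2)))"
  proof -
    have "(\<integral>\<^sup>+y\<in>ball x R. ?f y * w y \<partial>lborel)
      \<le> (\<integral>\<^sup>+y. ennreal (R powr - (real DIM('a) - \<beta>)) * (?f y * indicator (ball x R) y) \<partial>lborel)"
    proof (intro nn_integral_mono)
      fix y
      show "?f y * w y * indicator (ball x R) y \<le> ennreal (R powr - (real DIM('a) - \<beta>)) * (?f y * indicator (ball x R) y)"
      proof (cases "y \<in> ball x R")
        case True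
        then have "w y \<le> recip_powr R (real DIM('a) - \<beta>)"
          using R beta infdist_le_add_dist[of x y] by (intro recip_powr_antimono) (auto simp: dist_commute)
        then show ?thesis
          using True R(1) by (simp add: recip_powr_pos mult.commute mult_right_mono)
      qed simp
    qed
    also have "\<dots> = ennreal (R powr - (real DIM('a) - \<beta>)) * (\<integral>\<^sup>+y\<in>ball x R. ?f y \<partial>lborel)"
      by (rule nn_integral_cmult) (auto intro!: borel_measurable_times_ennreal borel_measurable_indicator)
    also have "\<dots> \<le> ennreal (R powr - (real DIM('a) - \<beta>)) * ennreal (?N * R powr 2)"
      using nn_integral_recip_powr_ball[OF R(1), of "real DIM('a) - 2" x] dim by (intro mult_left_mono) auto
    also have "\<dots> = ennreal (?N * (R powr - (real DIM('a) - \<beta>) * R powr 2))"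
      by (subst ennreal_mult'[symmetric]) (auto simp only: powr_ge_zero mult_ac)
    also have "R powr - (real DIM('a) - \<beta>) * R powr 2 = R powr (\<beta> - (real DIM('a) - 2))"
      unfolding powr_add[symmetric] by (rule arg_cong[of _ _ "\<lambda>s. R powr s"]) simp
    finally show ?thesis .
  qed
  have far: "(\<integral>\<^sup>+y\<in>- ball x R. ?f y * w y \<partial>lborel) \<le> ennreal (?F * R powr (\<beta> - (real DIM('a) - 2)))"
  proof -
    have "(\<integral>\<^sup>+y\<in>- ball x R. ?f y * w y \<partial>lborel)
      \<le> ennreal (2 powr \<beta> / (1 - 2 powr (\<beta> - (real DIM('a) - 2))) * (a * 3 powr \<beta>) * R powr (\<beta> - (real DIM('a) - 2)))"
    proof (rule nn_integral_recip_powr_outside_ball)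
      fix r assume r: "R \<le> r"
      \<comment> \<open>Here \<open>dist x p = 2 * R\<close>, which is at most \<open>2 * r\<close>.
        Recentering at \<open>p\<close> makes \<open>weight_bound\<close> applicable.\<close>
      have "ball x r \<subseteq> ball p (3 * r)"
      proof
        fix y assume "y \<in> ball x r"
        then show "y \<in> ball p (3 * r)"
          using r R p dist_triangle[of p y x] by (simp add: dist_commute)
      qed
      then have "(\<integral>\<^sup>+y\<in>ball x r. w y \<partial>lborel) \<le> (\<integral>\<^sup>+y\<in>ball p (3 * r). w y \<partial>lborel)"
        by (intro nn_integral_mono) (auto split: split_indicator)
      also have "\<dots> \<le> ennreal (a * (3 * r) powr \<beta>)"
        using p(1) r R by (intro weight_bound) auto
      finally show "(\<integral>\<^sup>+y\<in>ball x r. w y \<partial>lborel) \<le> ennreal (a * 3 powr \<beta> * r powr \<beta>)"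
        using r R by (simp add: powr_mult mult.assoc)
    qed (use R beta dim a_nonneg in auto)
    then show ?thesis by simp
  qed
  have "\<Phi> x = (\<integral>\<^sup>+y. ?f y * w y * indicator (ball x R) y + ?f y * w y * indicator (- ball x R) y \<partial>lborel)"
    by (intro nn_integral_cong) (auto split: split_indicator)
  also have "\<dots> = (\<integral>\<^sup>+y\<in>ball x R. ?f y * w y \<partial>lborel) + (\<integral>\<^sup>+y\<in>- ball x R. ?f y * w y \<partial>lborel)"
    by (rule nn_integral_add) (auto intro!: borel_measurable_times_ennreal borel_measurable_indicator)
  also have "\<dots> \<le> ennreal (?N * R powr (\<beta> - (real DIM('a) - 2))) + ennreal (?F * R powr (\<beta> - (real DIM('a) - 2)))"
    by (intro add_mono near far)
  also have "\<dots> = ennreal ((?N + ?F) * R powr (\<beta> - (real DIM('a) - 2)))"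
    using nonneg by (subst ennreal_plus[symmetric]) (auto simp only: distrib_right intro!: mult_nonneg_nonneg powr_ge_zero)
  \<comment> \<open>Replacing \<open>R\<close> by \<open>infdist x K = 2 * R\<close> yields the last
    factor of \<open>potential_upper_const\<close>.\<close>
  also have "R powr (\<beta> - (real DIM('a) - 2)) = 2 powr (real DIM('a) - 2 - \<beta>) * (2 * R) powr - (real DIM('a) - 2 - \<beta>)"
    using R(1) by (simp add: powr_mult powr_minus field_simps flip: powr_add)
  also have "ennreal ((?N + ?F) * (2 powr (real DIM('a) - 2 - \<beta>) * (2 * R) powr - (real DIM('a) - 2 - \<beta>)))
    = ennreal (potential_upper_const (real DIM('a)) \<beta> a) * recip_powr (infdist x K) (real DIM('a) - 2 - \<beta>)"
    using R by (simp add: potential_upper_const_def recip_powr_pos mult.assoc flip: ennreal_mult'')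
  finally show ?thesis .
qed

section \<open>Local integrability of the weight and the potential, and nullity of
  \<open>K\<close>\<close>

lemma compact_subset_ball:
  assumes "compact C"
  obtains p r where "p \<in> K" "0 < r" "C \<subseteq> ball p r"
  using bounded_subset_ballD[OF compact_imp_bounded[OF assms]] nonempty_K by blast

lemma nn_integral_weight_compact:
  assumes "compact C"
  shows "(\<integral>\<^sup>+y\<in>C. w y \<partial>lborel) < \<infinity>"
proof -
  obtain p r where pr: "p \<in> K" "0 < r" "C \<subseteq> ball p r"
    using compact_subset_ball[OF assms] .
  then have "(\<integral>\<^sup>+y\<in>C. w y \<partial>lborel) \<le> (\<integral>\<^sup>+y\<in>ball p r. w y \<partial>lborel)"
    by (intro nn_integral_mono) (auto split: split_indicator)
  also have "\<dots> \<le> ennreal (a * r powr \<beta>)"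
    using pr by (intro weight_bound)
  finally show ?thesis by (auto intro: le_less_trans)
qed

text \<open>The upper bound for \<open>\<Phi>\<close> is a constant times the square of the distance
  to \<open>K\<close> times \<open>w\<close>. On a ball of radius \<open>r\<close> about a point of
  \<open>K\<close> that distance is at most \<open>r\<close>, so local integrability of
  \<open>w\<close> suffices.\<close>

lemma nn_integral_potential_compact:
  assumes "compact C"
  shows "(\<integral>\<^sup>+x\<in>C. \<Phi> x \<partial>lborel) < \<infinity>"
proof -
  obtain p r where pr: "p \<in> K" "0 < r" "C \<subseteq> ball p r"
    using compact_subset_ball[OF assms] .
  let ?c = "ennreal (potential_upper_const (real DIM('a)) \<beta> a) * ennreal (r\<^sup>2)"
  have "recip_powr (infdist x K) (real DIM('a) - 2 - \<beta>) \<le> ennreal (r\<^sup>2) * w x" if "x \<in> ball p r" for x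
  proof (cases "infdist x K = 0")
    case False
    then have x: "0 < infdist x K"
      using infdist_nonneg[of x K] by simp
    have "infdist x K \<le> r"
      using infdist_le[OF pr(1), of x] that by (simp add: dist_commute)
    then have "(infdist x K)\<^sup>2 * infdist x K powr - (real DIM('a) - \<beta>) \<le> r\<^sup>2 * infdist x K powr - (real DIM('a) - \<beta>)"
      using x by (intro mult_right_mono power_mono) auto
    moreover have "(infdist x K)\<^sup>2 * infdist x K powr - (real DIM('a) - \<beta>) = infdist x K powr - (real DIM('a) - 2 - \<beta>)"
      using x by (intro power2_times_powr) simp_all
    ultimately have "infdist x K powr - (real DIM('a) - 2 - \<beta>) \<le> r\<^sup>2 * infdist x K powr - (real DIM('a) - \<beta>)"
      by (simp only:)
    then show ?thesis
      using x by (simp add: recip_powr_pos flip: ennreal_mult')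
  qed (use pr in \<open>simp add: ennreal_mult_top\<close>)
  then have bound: "\<Phi> x \<le> ?c * w x" if "x \<in> ball p r" for x
    using potential_upper_bound[of x] that
    by (metis (no_types, lifting) mult.assoc mult_left_mono order_trans zero_le)
  have "(\<integral>\<^sup>+x\<in>C. \<Phi> x \<partial>lborel) \<le> (\<integral>\<^sup>+x. ?c * (w x * indicator (ball p r) x) \<partial>lborel)"
    using pr bound by (intro nn_integral_mono) (auto simp: mult.assoc split: split_indicator)
  also have "\<dots> = ?c * (\<integral>\<^sup>+x\<in>ball p r. w x \<partial>lborel)"
    by (rule nn_integral_cmult) (auto intro!: borel_measurable_times_ennreal borel_measurable_indicator)
  also have "\<dots> < \<infinity>"
    using le_less_trans[OF weight_bound[OF pr(1,2)] ennreal_less_top]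
    by (simp add: ennreal_mult_less_top)
  finally show ?thesis .
qed

text \<open>Finiteness of the integral holds on each ball of integer radius about 0, and countably
  many exceptional null sets are combined.\<close>

lemma AE_weight_finite: "AE y in lborel. w y < \<infinity>"
proof -
  have "AE y in lborel. w y * indicator (cball 0 (real n)) y \<noteq> \<infinity>" for n
    using nn_integral_weight_compact[of "cball 0 (real n)"]
    by (intro nn_integral_noteq_infinite) (auto intro!: borel_measurable_times_ennreal borel_measurable_indicator)
  then have "AE y in lborel. \<forall>n. w y * indicator (cball 0 (real n)) y \<noteq> \<infinity>"
    by (simp add: AE_all_countable)
  then show ?thesis
  proof eventually_elim
    fix y assume y: "\<forall>n. w y * indicator (cball 0 (real n)) y \<noteq> \<infinity>"
    obtain n where "norm y \<le> real n"
      using real_arch_simple by blast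
    then show "w y < \<infinity>"
      using y[rule_format, of n] by (simp add: less_top)
  qed
qed

text \<open>The weight is infinite on the closed set \<open>K\<close>, so a ball inside
  \<open>K\<close> would be null. This later identifies the frontier of \<open>\<Omega>\<close> with
  its complement.\<close>

lemma interior_K: "interior K = {}"
proof (rule ccontr)
  assume "interior K \<noteq> {}"
  then obtain z e where e: "0 < e" "ball z e \<subseteq> K"
    by (auto simp: mem_interior)
  have "AE y in lborel. y \<notin> ball z e"
    using AE_weight_finite by eventually_elim (use e in auto)
  then have "emeasure lborel (ball z e) = 0"
    using AE_iff_measurable[of "ball z e" lborel "\<lambda>y. y \<notin> ball z e"] by (simp add: ball_def)
  then show False using e unit_ball_vol_pos[of "real DIM('a)"] by (simp add: emeasure_ball)
qed

section \<open>The distributional Laplacian of the potential by Fubini\<close>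

lemma AE_kernel_weight:
  "AE y in lborel. recip_powr (norm (x - y)) (real DIM('a) - 2) * w y
     = ennreal (norm (x - y) powr (2 - real DIM('a)) * enn2real (w y))"
  using AE_weight_finite AE_lborel_singleton[of x]
proof eventually_elim
  \<comment> \<open>Both exceptions are genuine: \<open>enn2real\<close> sends an infinite weight to
    0, and at \<open>y = x\<close> the left kernel is infinite while \<open>powr\<close> gives
    0.\<close>
  fix y assume "w y < \<infinity>" "y \<noteq> x"
  then show "recip_powr (norm (x - y)) (real DIM('a) - 2) * w y = ennreal (norm (x - y) powr (2 - real DIM('a)) * enn2real (w y))"
    using recip_powr_pos[of "norm (x - y)" "real DIM('a) - 2"] by (simp add: ennreal_mult')
qed

text \<open>This is an identity at every \<open>x\<close>: where \<open>\<Phi> x\<close> is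
  infinite, both \<open>enn2real\<close> and the integral of a non-integrable function take the
  default value 0.\<close>

lemma enn2real_potential:
  "enn2real (\<Phi> x) = (\<integral>y. norm (x - y) powr (2 - real DIM('a)) * enn2real (w y) \<partial>lborel)"
  using nn_integral_cong_AE[OF AE_kernel_weight, of x]
  by (subst integral_eq_nn_integral) auto

text \<open>Local integrability of \<open>\<Phi>\<close> and boundedness of the compactly supported
  Laplacian of \<open>\<zeta>\<close> give absolute integrability on the product space. After
  exchanging the integrals, the inner one is the fundamental solution tested at \<open>y\<close>,
  multiplied by the weight.\<close>

lemma integral_potential_laplacian:
  assumes \<zeta>: "test_function \<zeta>"
  shows "(\<integral>x. enn2real (\<Phi> x) * laplacian \<zeta> x \<partial>lborel)
    = - (newton_const TYPE('a) * (\<integral>y. enn2real (w y) * \<zeta> y \<partial>lborel))"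
proof -
  obtain C where C: "compact C" and supp: "\<And>x. x \<notin> C \<Longrightarrow> \<zeta> x = 0"
    using test_function_support[OF \<zeta>] by blast
  have lsupp: "laplacian \<zeta> x = 0" if "x \<notin> C" for x
    using laplacian_eq_0_outside_support[OF compact_imp_closed[OF C] supp that] .
  note lcont = test_function_laplacian_continuous[OF \<zeta>]
  have [measurable]: "laplacian \<zeta> \<in> borel_measurable borel"
    using lcont by (rule borel_measurable_continuous_onI)
  obtain M where M: "0 < M" "\<And>x. \<bar>laplacian \<zeta> x\<bar> \<le> M"
    using bounded_continuous_compact_support[OF lcont C lsupp] by blast
  let ?k = "\<lambda>x y. norm (x - y) powr (2 - real DIM('a)) * enn2real (w y)"
  have "integrable (lborel \<Otimes>\<^sub>M lborel) (\<lambda>(x, y). ?k x y * laplacian \<zeta> x)"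
  proof (rule integrableI_bounded)
    show meas: "(\<lambda>(x, y). ?k x y * laplacian \<zeta> x) \<in> borel_measurable (lborel \<Otimes>\<^sub>M lborel)"
      by measurable
    have "(\<integral>\<^sup>+z. ennreal (norm (case z of (x, y) \<Rightarrow> ?k x y * laplacian \<zeta> x)) \<partial>(lborel \<Otimes>\<^sub>M lborel))
      = (\<integral>\<^sup>+x. \<integral>\<^sup>+y. ennreal (norm (?k x y * laplacian \<zeta> x)) \<partial>lborel \<partial>lborel)"
      using meas by (subst lborel.nn_integral_fst[symmetric]) auto
    also have "\<dots> = (\<integral>\<^sup>+x. ennreal \<bar>laplacian \<zeta> x\<bar> * \<Phi> x \<partial>lborel)"
    proof (intro nn_integral_cong)
      fix x
      have "(\<integral>\<^sup>+y. ennreal (norm (?k x y * laplacian \<zeta> x)) \<partial>lborel)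
        = (\<integral>\<^sup>+y. ennreal \<bar>laplacian \<zeta> x\<bar> * ennreal (?k x y) \<partial>lborel)"
        by (intro nn_integral_cong) (simp add: abs_mult mult.commute flip: ennreal_mult')
      also have "\<dots> = ennreal \<bar>laplacian \<zeta> x\<bar> * (\<integral>\<^sup>+y. ennreal (?k x y) \<partial>lborel)"
        by (intro nn_integral_cmult) measurable
      finally show "(\<integral>\<^sup>+y. ennreal (norm (?k x y * laplacian \<zeta> x)) \<partial>lborel) = ennreal \<bar>laplacian \<zeta> x\<bar> * \<Phi> x"
        using nn_integral_cong_AE[OF AE_kernel_weight, of x] by simp
    qed
    also have "\<dots> \<le> (\<integral>\<^sup>+x. ennreal M * (\<Phi> x * indicator C x) \<partial>lborel)"
    proof (intro nn_integral_mono)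
      fix x
      show "ennreal \<bar>laplacian \<zeta> x\<bar> * \<Phi> x \<le> ennreal M * (\<Phi> x * indicator C x)"
        using M(2)[of x] lsupp[of x] by (cases "x \<in> C") (auto intro!: mult_right_mono ennreal_leI)
    qed
    also have "\<dots> = ennreal M * (\<integral>\<^sup>+x\<in>C. \<Phi> x \<partial>lborel)"
      using C by (intro nn_integral_cmult)
        (auto intro!: borel_measurable_times_ennreal borel_measurable_indicator borel_compact)
    also have "\<dots> < \<infinity>"
      using nn_integral_potential_compact[OF C] by (simp add: ennreal_mult_less_top)
    finally show "(\<integral>\<^sup>+z. ennreal (norm (case z of (x, y) \<Rightarrow> ?k x y * laplacian \<zeta> x)) \<partial>(lborel \<Otimes>\<^sub>M lborel)) < \<infinity>" .
  qed
  from lborel_pair.Fubini_integral[OF this]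
  have "(\<integral>x. (\<integral>y. ?k x y * laplacian \<zeta> x \<partial>lborel) \<partial>lborel)
    = (\<integral>y. (\<integral>x. ?k x y * laplacian \<zeta> x \<partial>lborel) \<partial>lborel)"
    by simp
  moreover have "(\<integral>y. ?k x y * laplacian \<zeta> x \<partial>lborel) = enn2real (\<Phi> x) * laplacian \<zeta> x" for x
    by (subst enn2real_potential) (rule integral_mult_left_zero)
  moreover have "(\<integral>x. ?k x y * laplacian \<zeta> x \<partial>lborel)
      = - newton_const TYPE('a) * (enn2real (w y) * \<zeta> y)" for y
  proof -
    have "(\<integral>x. ?k x y * laplacian \<zeta> x \<partial>lborel)
      = (\<integral>x. enn2real (w y) * (norm (x - y) powr (2 - real DIM('a)) * laplacian \<zeta> x) \<partial>lborel)"
      by (intro Bochner_Integration.integral_cong) (auto simp only: mult_ac)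
    also have "\<dots> = enn2real (w y) * (- newton_const TYPE('a) * \<zeta> y)"
      using dim \<zeta> by (subst integral_mult_right_zero) (simp add: newton_kernel_fundamental_solution)
    finally show ?thesis by simp
  qed
  ultimately show ?thesis
    by (simp only: integral_mult_right_zero minus_mult_left)
qed

end

section \<open>Translation to the extended real formulation, and assembly\<close>

lemma locally_integrable_enn2ereal:
  assumes [measurable]: "u \<in> borel_measurable borel"
    and "\<And>C. compact C \<Longrightarrow> (\<integral>\<^sup>+x\<in>C. u x \<partial>lborel) < \<infinity>"
  shows "locally_integrable (\<lambda>x. enn2ereal (u x))"
  using assms(2) by (simp add: locally_integrable_def)

lemma neg_laplacian_distr_imp_superharmonic:
  assumes "neg_laplacian_distr u f" "\<And>x. 0 \<le> f x"
  shows "superharmonic u"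
  unfolding superharmonic_def
proof (intro conjI allI impI)
  show "locally_integrable u"
    using assms(1) by (simp add: neg_laplacian_distr_def)
  fix \<zeta> :: "'a \<Rightarrow> real" assume \<zeta>: "test_function \<zeta> \<and> (\<forall>x. 0 \<le> \<zeta> x)"
  then have "0 \<le> (\<integral>x. real_of_ereal (f x) * \<zeta> x \<partial>lborel)"
    using assms(2) by (intro integral_nonneg_AE AE_I2 mult_nonneg_nonneg real_of_ereal_pos) auto
  moreover have "- (\<integral>x. real_of_ereal (u x) * laplacian \<zeta> x \<partial>lborel) = (\<integral>x. real_of_ereal (f x) * \<zeta> x \<partial>lborel)"
    using assms(1) \<zeta> unfolding neg_laplacian_distr_def by blast
  ultimately show "(\<integral>x. real_of_ereal (u x) * laplacian \<zeta> x \<partial>lborel) \<le> 0"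
    by linarith
qed

text \<open>For \<open>r > 0\<close> the number \<open>r powr \<beta>\<close> is positive and
  finite, so the division in \<open>ennreal\<close> can be undone by multiplication; finiteness of
  \<open>A\<close> allows the real constant \<open>enn2real A\<close>.\<close>

lemma le_of_SUP_rescaled:
  fixes I :: "'a \<Rightarrow> real \<Rightarrow> ennreal"
  assumes "(SUP (p, r)\<in>S \<times> {0<..}. 1 / ennreal (r powr \<beta>) * I p r) \<le> A" "A < \<infinity>" "p \<in> S" "0 < r"
  shows "I p r \<le> ennreal (enn2real A * r powr \<beta>)"
proof -
  have "1 / ennreal (r powr \<beta>) * I p r \<le> A"
    using assms(1,3,4) by (auto simp: SUP_le_iff)
  then have "ennreal (r powr \<beta>) * (1 / ennreal (r powr \<beta>) * I p r) \<le> ennreal (r powr \<beta>) * A"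
    by (rule mult_left_mono) simp
  moreover have "ennreal (r powr \<beta>) * (1 / ennreal (r powr \<beta>)) = 1"
    using assms(4) by (simp add: divide_ennreal flip: ennreal_1 ennreal_mult')
  ultimately have "I p r \<le> ennreal (r powr \<beta>) * A"
    by (simp add: mult.assoc[symmetric])
  also have "\<dots> = ennreal (enn2real A * r powr \<beta>)"
    using assms(2) by (simp add: ennreal_mult' mult.commute)
  finally show ?thesis .
qed

theorem theorem5p21:
  assumes "DIM('a::euclidean_space) \<ge> 3"
  shows "\<exists>Nd::real. Nd > 0 \<and>
    (\<forall>(\<beta>::real) A::ennreal. \<beta> < real DIM('a) - 2 \<and> A < \<infinity> \<longrightarrow>
      (\<exists>N::real. N > 0 \<and>
        (\<forall>\<Omega>::'a set. open \<Omega> \<and> connected \<Omega> \<and> \<Omega> \<noteq> {} \<and> \<Omega> \<noteq> UNIV \<and>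
          (SUP (p, r)\<in>(- \<Omega>) \<times> {0<..}. 1 / ennreal (r powr \<beta>) *
             (\<integral>\<^sup>+y\<in>ball p r. recip_powr (infdist y (- \<Omega>)) (real DIM('a) - \<beta>) \<partial>lborel)) \<le> A
          \<longrightarrow>
          superharmonic (\<lambda>x. enn2ereal (potential \<Omega> \<beta> x)) \<and>
          neg_laplacian_distr (\<lambda>x. enn2ereal (potential \<Omega> \<beta> x))
            (\<lambda>x. ereal Nd * enn2ereal (recip_powr (bdist \<Omega> x) (real DIM('a) - \<beta>))) \<and>
          (\<forall>x. ennreal (1 / N) * recip_powr (bdist \<Omega> x) (real DIM('a) - 2 - \<beta>) \<le> potential \<Omega> \<beta> x \<and>
               potential \<Omega> \<beta> x \<le> ennreal N * recip_powr (bdist \<Omega> x) (real DIM('a) - 2 - \<beta>)))))"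
\<comment> \<open>This constant depends on the type alone and is therefore fixed before
  \<open>\<beta>\<close>, \<open>A\<close> and \<open>\<Omega>\<close>.\<close>
proof (rule exI[of _ "newton_const TYPE('a)"], intro conjI allI impI)
  show "0 < newton_const TYPE('a)"
    using assms by (rule newton_const_pos)
next
  fix \<beta> :: real and A :: ennreal
  assume \<beta>A: "\<beta> < real DIM('a) - 2 \<and> A < \<infinity>"
  let ?d = "real DIM('a)"
  let ?Nd = "newton_const TYPE('a)"
  let ?c = "unit_ball_vol ?d * 2 powr (\<beta> - ?d)"
  let ?C = "potential_upper_const ?d \<beta> (enn2real A)"
  \<comment> \<open>One constant serves both bounds: its reciprocal lies below the lower constant
    and it lies above the upper one. It involves only the dimension, \<open>\<beta>\<close> and
    \<open>A\<close>.\<close>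
  define N where "N = max (1 / ?c) ?C"
  have c: "0 < ?c" by simp
  then have N: "0 < N" unfolding N_def by (meson less_max_iff_disj zero_less_divide_1_iff)
  have Nc: "1 / N \<le> ?c"
  proof -
    have "1 / ?c \<le> N" by (simp add: N_def)
    then show ?thesis using c N by (simp add: field_simps)
  qed
  have NC: "?C \<le> N" by (simp add: N_def)
  show "\<exists>N::real. N > 0 \<and>
        (\<forall>\<Omega>::'a set. open \<Omega> \<and> connected \<Omega> \<and> \<Omega> \<noteq> {} \<and> \<Omega> \<noteq> UNIV \<and>
          (SUP (p, r)\<in>(- \<Omega>) \<times> {0<..}. 1 / ennreal (r powr \<beta>) *
             (\<integral>\<^sup>+y\<in>ball p r. recip_powr (infdist y (- \<Omega>)) (real DIM('a) - \<beta>) \<partial>lborel)) \<le> A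
          \<longrightarrow>
          superharmonic (\<lambda>x. enn2ereal (potential \<Omega> \<beta> x)) \<and>
          neg_laplacian_distr (\<lambda>x. enn2ereal (potential \<Omega> \<beta> x))
            (\<lambda>x. ereal ?Nd * enn2ereal (recip_powr (bdist \<Omega> x) (real DIM('a) - \<beta>))) \<and>
          (\<forall>x. ennreal (1 / N) * recip_powr (bdist \<Omega> x) (real DIM('a) - 2 - \<beta>) \<le> potential \<Omega> \<beta> x \<and>
               potential \<Omega> \<beta> x \<le> ennreal N * recip_powr (bdist \<Omega> x) (real DIM('a) - 2 - \<beta>)))"
  proof (rule exI[of _ N], intro conjI[OF N] allI impI)
    fix \<Omega> :: "'a set"
    assume \<Omega>: "open \<Omega> \<and> connected \<Omega> \<and> \<Omega> \<noteq> {} \<and> \<Omega> \<noteq> UNIV \<and>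
          (SUP (p, r)\<in>(- \<Omega>) \<times> {0<..}. 1 / ennreal (r powr \<beta>) *
             (\<integral>\<^sup>+y\<in>ball p r. recip_powr (infdist y (- \<Omega>)) (real DIM('a) - \<beta>) \<partial>lborel)) \<le> A"
    interpret singular_weight "- \<Omega>" \<beta> "enn2real A"
    proof
      show "(\<integral>\<^sup>+y\<in>ball p r. recip_powr (infdist y (- \<Omega>)) (real DIM('a) - \<beta>) \<partial>lborel)
        \<le> ennreal (enn2real A * r powr \<beta>)" if "p \<in> - \<Omega>" "0 < r" for p r
        using le_of_SUP_rescaled[where I = "\<lambda>p r. \<integral>\<^sup>+y\<in>ball p r. recip_powr (infdist y (- \<Omega>)) (real DIM('a) - \<beta>) \<partial>lborel"]
          \<Omega> \<beta>A that by blast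
    qed (use assms \<beta>A \<Omega> in auto)
    \<comment> \<open>A closed set with empty interior is its own frontier, and complementary sets
      share their frontier.\<close>
    have "frontier \<Omega> = - \<Omega>"
      using interior_K closed_K frontier_complement[of \<Omega>] by (simp add: frontier_def)
    then have bdist: "bdist \<Omega> x = infdist x (- \<Omega>)" for x
      by (simp add: bdist_def)
    have pot: "potential \<Omega> \<beta> x = \<Phi> x" for x
      by (simp add: potential_def bdist)
    have f: "ereal ?Nd * enn2ereal (w x) = enn2ereal (ennreal ?Nd * w x)" for x
      using newton_const_pos[OF assms] by (simp add: times_ennreal.rep_eq enn2ereal_ennreal)
    have "neg_laplacian_distr (\<lambda>x. enn2ereal (\<Phi> x)) (\<lambda>x. enn2ereal (ennreal ?Nd * w x))"
      unfolding neg_laplacian_distr_def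
    proof (intro conjI allI impI)
      show "locally_integrable (\<lambda>x. enn2ereal (\<Phi> x))"
        by (intro locally_integrable_enn2ereal measurable_potential nn_integral_potential_compact)
      show "locally_integrable (\<lambda>x. enn2ereal (ennreal ?Nd * w x))"
      proof (rule locally_integrable_enn2ereal)
        fix C :: "'a set" assume C: "compact C"
        have "(\<integral>\<^sup>+x\<in>C. ennreal ?Nd * w x \<partial>lborel) = ennreal ?Nd * (\<integral>\<^sup>+x\<in>C. w x \<partial>lborel)"
          using C unfolding mult.assoc by (intro nn_integral_cmult)
            (auto intro!: borel_measurable_times_ennreal borel_measurable_indicator borel_compact)
        then show "(\<integral>\<^sup>+x\<in>C. ennreal ?Nd * w x \<partial>lborel) < \<infinity>"
          using nn_integral_weight_compact[OF C] by (simp add: ennreal_mult_less_top)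
      qed measurable
      fix \<zeta> :: "'a \<Rightarrow> real" assume \<zeta>: "test_function \<zeta>"
      have "enn2real (ennreal ?Nd * w x) * \<zeta> x = ?Nd * (enn2real (w x) * \<zeta> x)" for x
        using newton_const_pos[OF assms] by (simp add: enn2real_mult)
      \<comment> \<open>By definition \<open>enn2real\<close> is \<open>real_of_ereal\<close> after
        \<open>enn2ereal\<close>, so folding it reduces the goal to the identity for
        \<open>\<Phi>\<close>.\<close>
      then show "- (\<integral>x. real_of_ereal (enn2ereal (\<Phi> x)) * laplacian \<zeta> x \<partial>lborel)
        = (\<integral>x. real_of_ereal (enn2ereal (ennreal ?Nd * w x)) * \<zeta> x \<partial>lborel)"
        using integral_potential_laplacian[OF \<zeta>]
        by (simp only: enn2real_def[symmetric] integral_mult_right_zero minus_minus)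
    qed
    then have distr: "neg_laplacian_distr (\<lambda>x. enn2ereal (potential \<Omega> \<beta> x))
        (\<lambda>x. ereal ?Nd * enn2ereal (recip_powr (bdist \<Omega> x) (real DIM('a) - \<beta>)))"
      by (simp only: pot bdist f)
    moreover have "superharmonic (\<lambda>x. enn2ereal (potential \<Omega> \<beta> x))"
      using newton_const_pos[OF assms] by (intro neg_laplacian_distr_imp_superharmonic[OF distr]) auto
    moreover have "ennreal (1 / N) * recip_powr (bdist \<Omega> x) (real DIM('a) - 2 - \<beta>) \<le> potential \<Omega> \<beta> x" for x
      unfolding pot bdist using potential_lower_bound[of x] Nc
      by (meson ennreal_leI mult_right_mono order_trans zero_le)
    moreover have "potential \<Omega> \<beta> x \<le> ennreal N * recip_powr (bdist \<Omega> x) (real DIM('a) - 2 - \<beta>)" for x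
      unfolding pot bdist using potential_upper_bound[of x] NC
      by (meson ennreal_leI mult_right_mono order_trans zero_le)
    ultimately show "superharmonic (\<lambda>x. enn2ereal (potential \<Omega> \<beta> x)) \<and>
          neg_laplacian_distr (\<lambda>x. enn2ereal (potential \<Omega> \<beta> x))
            (\<lambda>x. ereal ?Nd * enn2ereal (recip_powr (bdist \<Omega> x) (real DIM('a) - \<beta>))) \<and>
          (\<forall>x. ennreal (1 / N) * recip_powr (bdist \<Omega> x) (real DIM('a) - 2 - \<beta>) \<le> potential \<Omega> \<beta> x \<and>
               potential \<Omega> \<beta> x \<le> ennreal N * recip_powr (bdist \<Omega> x) (real DIM('a) - 2 - \<beta>))"
      by blast
  qed
qed

end
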